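(* Let $p$ be an odd prime. The following congruences modulo $p^5$ hold for $p \geq 7$, and the following congruences modulo $p^6$ hold for $p \geq 11$. (1) For $Q_p(1)$: $$Q_p(1) \equiv (p-1) \overline{\mathcal{B}}_1 - p^2 \overline{\mathcal{B}}_{1,2} + \tfrac{11}{6} p^3 \overline{\mathcal{B}}_{1,2} - p^4 (\overline{\mathcal{B}}_{1,2} + \overline{\mathcal{B}}_{1,4}) + p^5 \left(\tfrac{1}{6} \overline{\mathcal{B}}_{1,2} + \tfrac{137}{60} \overline{\mathcal{B}}_{1,4}\right) \pmod{p^6},$$ $$Q_p(1) \equiv (p-1) \overline{\mathcal{B}}_1 - p^2 \overline{\mathcal{B}}_{1,2} + \tfrac{11}{6} p^3 \overline{\mathcal{B}}_{1,2} - p^4 (\overline{\mathcal{B}}_{1,2} + \overline{\mathcal{B}}_{1,4}) \pmod{p^5}.$$ (2) For $Q_p(2)$: $$\begin{aligned}\tfrac{1}{2} p \, Q_p(2) &\equiv (p-1) (\overline{\mathcal{B}}_2 - \overline{\mathcal{B}}_1) + p^2 (\overline{\mathcal{B}}_{1,2} - 2 \overline{\mathcal{B}}_{2,2}) + p^3 \left(-\tfrac{11}{6} \overline{\mathcal{B}}_{1,2} + \tfrac{13}{3} \overline{\mathcal{B}}_{2,2}\right) \\ &\quad + p^4 (\overline{\mathcal{B}}_{1,2} - 3 \overline{\mathcal{B}}_{2,2} + \overline{\mathcal{B}}_{1,4} - 3 \overline{\mathcal{B}}_{2,4}) + p^5 \left(\tfrac{1}{2} \overline{\mathcal{B}}_{1,2}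 + \tfrac{77}{12} \overline{\mathcal{B}}_{1,4}\right) \pmod{p^6},\end{aligned}$$ $$\tfrac{1}{2} p \, Q_p(2) \equiv (p-1) (\overline{\mathcal{B}}_2 - \overline{\mathcal{B}}_1) + p^2 (\overline{\mathcal{B}}_{1,2} - 2 \overline{\mathcal{B}}_{2,2}) + p^3 \left(-\tfrac{11}{6} \overline{\mathcal{B}}_{1,2} + \tfrac{13}{3} \overline{\mathcal{B}}_{2,2}\right) - p^4 (2 \overline{\mathcal{B}}_{1,2} + 2 \overline{\mathcal{B}}_{1,4}) \pmod{p^5}.$$ (3) For $Q_p(3)$: $$\begin{aligned}\tfrac{1}{3} p^2 Q_p(3) &\equiv (p-1) (\overline{\mathcal{B}}_3 - 2 \overline{\mathcal{B}}_2 + \overline{\mathcal{B}}_1) + p^2 \left(-\overline{\mathcal{B}}_{1,2} + 4 \overline{\mathcal{B}}_{2,2} - \tfrac{10}{3} \overline{\mathcal{B}}_{3,2}\right) \\ &\quad + p^3 \left(\tfrac{11}{6} \overline{\mathcal{B}}_{1,2} - \tfrac{26}{3} \overline{\mathcal{B}}_{2,2} + \tfrac{47}{6} \overline{\mathcal{B}}_{3,2}\right) + p^4 (5 \overline{\mathcal{B}}_{1,2} - 6 \overline{\mathcal{B}}_{2,2} + 6 \overline{\mathcal{B}}_{1,4} - 8 \overline{\mathcal{B}}_{2,4}) \\ &\quad + p^5 \left(\tfrac{1}{3} \overline{\mathcal{B}}_{1,2} + \tfrac{47}{6} \overline{\mathcal{B}}_{1,4}\right) \pmod{p^6},\end{aligned}$$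 $$\begin{aligned}\tfrac{1}{3} p^2 Q_p(3) &\equiv (p-1) (\overline{\mathcal{B}}_3 - 2 \overline{\mathcal{B}}_2 + \overline{\mathcal{B}}_1) + p^2 \left(-\overline{\mathcal{B}}_{1,2} + 4 \overline{\mathcal{B}}_{2,2} - \tfrac{10}{3} \overline{\mathcal{B}}_{3,2}\right) \\ &\quad + p^3 (-6 \overline{\mathcal{B}}_{1,2} + 7 \overline{\mathcal{B}}_{2,2}) - p^4 (\overline{\mathcal{B}}_{1,2} + 2 \overline{\mathcal{B}}_{1,4}) \pmod{p^5}.\end{aligned}$$ (4) For $Q_p(4)$: $$\begin{aligned}\tfrac{1}{4} p^3 Q_p(4) &\equiv (p-1) (\overline{\mathcal{B}}_4 - 3 \overline{\mathcal{B}}_3 + 3 \overline{\mathcal{B}}_2 - \overline{\mathcal{B}}_1) + p^2 (\overline{\mathcal{B}}_{1,2} - 6 \overline{\mathcal{B}}_{2,2} + 10 \overline{\mathcal{B}}_{3,2} - 5 \overline{\mathcal{B}}_{4,2}) \\ &\quad + p^3 \left(\tfrac{21}{2} \overline{\mathcal{B}}_{1,2} - 24 \overline{\mathcal{B}}_{2,2} + \tfrac{27}{2} \overline{\mathcal{B}}_{3,2}\right) + p^4 (3 \overline{\mathcal{B}}_{1,2} - 3 \overline{\mathcal{B}}_{2,2} + 8 \overline{\mathcal{B}}_{1,4} - 9 \overline{\mathcal{B}}_{2,4}) \\ &\quad + \tfrac{9}{2} p^5 \overline{\mathcal{B}}_{1,4} \pmod{p^6},\end{aligned}$$ $$\begin{aligned}\tfrac{1}{4}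 p^3 Q_p(4) &\equiv (p-1) (\overline{\mathcal{B}}_4 - 3 \overline{\mathcal{B}}_3 + 3 \overline{\mathcal{B}}_2 - \overline{\mathcal{B}}_1) + p^2 (-4 \overline{\mathcal{B}}_{1,2} + 9 \overline{\mathcal{B}}_{2,2} - 5 \overline{\mathcal{B}}_{3,2}) \\ &\quad + p^3 (-3 \overline{\mathcal{B}}_{1,2} + 3 \overline{\mathcal{B}}_{2,2}) - p^4 \overline{\mathcal{B}}_{1,4} \pmod{p^5}.\end{aligned}$$ (5) For $Q_p(5)$: $$\begin{aligned}\tfrac{1}{5} p^4 Q_p(5) &\equiv (p-1) (\overline{\mathcal{B}}_5 - 4 \overline{\mathcal{B}}_4 + 6 \overline{\mathcal{B}}_3 - 4 \overline{\mathcal{B}}_2 + \overline{\mathcal{B}}_1) + p^2 (6 \overline{\mathcal{B}}_{1,2} - 20 \overline{\mathcal{B}}_{2,2} + 22 \overline{\mathcal{B}}_{3,2} - 8 \overline{\mathcal{B}}_{4,2}) \\ &\quad + p^3 (6 \overline{\mathcal{B}}_{1,2} - 12 \overline{\mathcal{B}}_{2,2} + 6 \overline{\mathcal{B}}_{3,2}) + p^4 \left(\tfrac{23}{5} \overline{\mathcal{B}}_{1,4} - \tfrac{24}{5} \overline{\mathcal{B}}_{2,4}\right) + p^5 \overline{\mathcal{B}}_{1,4} \pmod{p^6},\end{aligned}$$ $$\begin{aligned}\tfrac{1}{5} p^4 Q_p(5) &\equiv -(\overline{\mathcal{B}}_5 - 4 \overline{\mathcal{B}}_4 + 6 \overline{\mathcal{B}}_3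 - 4 \overline{\mathcal{B}}_2 + \overline{\mathcal{B}}_1) + p^2 (-2 \overline{\mathcal{B}}_{1,2} + 4 \overline{\mathcal{B}}_{2,2} - 2 \overline{\mathcal{B}}_{3,2}) \\ &\quad - \tfrac{1}{5} p^4 \overline{\mathcal{B}}_{1,4} \pmod{p^5}.\end{aligned}$$ (6) For $Q_p(6)$: $$\begin{aligned}\tfrac{1}{6} p^5 Q_p(6) &\equiv -(\overline{\mathcal{B}}_6 - 5 \overline{\mathcal{B}}_5 + 10 \overline{\mathcal{B}}_4 - 10 \overline{\mathcal{B}}_3 + 5 \overline{\mathcal{B}}_2 - \overline{\mathcal{B}}_1) \\ &\quad + p^2 \left(\tfrac{10}{3} \overline{\mathcal{B}}_{1,2} - 10 \overline{\mathcal{B}}_{2,2} + 10 \overline{\mathcal{B}}_{3,2} - \tfrac{10}{3} \overline{\mathcal{B}}_{4,2}\right) + p^4 (\overline{\mathcal{B}}_{1,4} - \overline{\mathcal{B}}_{2,4}) \pmod{p^6}.\end{aligned}$$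
   Context: For a prime $p$ and $1 \leq a < p$, the Fermat quotient is the integer $q_p(a) = \frac{a^{p-1}-1}{p}$, and for $n \geq 1$ the power sums of the Fermat quotients are $Q_p(n) = \sum_{a=1}^{p-1} q_p(a)^n$. The Bernoulli numbers $B_n \in \mathbb{Q}$ are defined by $\frac{t}{e^t-1} = \sum_{n \geq 0} B_n \frac{t^n}{n!}$. For a prime $p \geq 7$ and integers $n \geq 1$, define the divided Bernoulli numbers $$\overline{\mathcal{B}}_n = \frac{B_{n(p-1)} + \frac{1}{p} - 1}{n(p-1)}, \qquad \overline{\mathcal{B}}_{n,d} = \frac{B_{n(p-1)-d}}{n(p-1)-d} \quad (d \in \{2,4\}).$$ For the indices occurring in the claim these are $p$-integral rational numbers, i.e. elements of $\mathbb{Q} \cap \mathbb{Z}_p$, where $\mathbb{Z}_p$ is the ring of $p$-adic integers. Subscripts $\overline{\mathcal{B}}_{n,d}$ have first index $n$ and second index $d$. A congruence $a \equiv b \pmod{p^k}$ between elements of $\mathbb{Z}_p$ means $a - b \in p^k \mathbb{Z}_p$. *)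

theory Defs
  imports
    "HOL-Computational_Algebra.Formal_Power_Series"
    "HOL-Number_Theory.Number_Theory"
begin

definition bernoulli :: "nat \<Rightarrow> rat" where
  "bernoulli n = fact n * fps_nth (fps_X / (fps_exp 1 - 1)) n"

text \<open>The quotient of formal power series in \<^const>\<open>bernoulli\<close> is exact, so it is the usual
  exponential generating function.\<close>

lemma bernoulli_egf:
  "Abs_fps (\<lambda>n. bernoulli n / fact n) * (fps_exp 1 - 1) = fps_X"
proof -
  have nz: "fps_exp (1::rat) - 1 \<noteq> 0"
  proof
    assume "fps_exp (1::rat) - 1 = 0"
    then have "fps_nth (fps_exp (1::rat) - 1) 1 = 0" by simp
    then show False by simp
  qed
  have "subdegree (fps_exp (1::rat) - 1) \<le> 1"
    by (rule subdegree_leI) simp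
  then have "fps_exp (1::rat) - 1 dvd fps_X"
    using nz by (simp add: fps_dvd_iff)
  moreover have "Abs_fps (\<lambda>n. bernoulli n / fact n) = fps_X / (fps_exp 1 - 1)"
    by (simp add: fps_eq_iff bernoulli_def)
  ultimately show ?thesis
    by simp
qed

definition fermat_quotient :: "nat \<Rightarrow> nat \<Rightarrow> int" where
  "fermat_quotient p a = (int a ^ (p - 1) - 1) div int p"

text \<open>The integer division in \<^const>\<open>fermat_quotient\<close> is exact in the intended range.\<close>

lemma fermat_quotient_exact:
  assumes "prime p" "1 \<le> a" "a < p"
  shows "int p * fermat_quotient p a = int a ^ (p - 1) - 1"
proof -
  have "\<not> p dvd a"
    using assms by (auto dest: dvd_imp_le)
  then have "[a ^ (p - 1) = 1] (mod p)"
    using assms by (intro fermat_theorem)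
  then have "[int a ^ (p - 1) = 1] (mod int p)"
    by (metis cong_int_iff of_nat_1 of_nat_power)
  then have "int p dvd int a ^ (p - 1) - 1"
    by (simp add: cong_iff_dvd_diff)
  then show ?thesis
    by (simp add: fermat_quotient_def)
qed

definition fermat_quotient_sum :: "nat \<Rightarrow> nat \<Rightarrow> int" where
  "fermat_quotient_sum p n = (\<Sum>a = 1..p - 1. fermat_quotient p a ^ n)"

definition div_bernoulli :: "nat \<Rightarrow> nat \<Rightarrow> rat" where
  "div_bernoulli p n =
     (bernoulli (n * (p - 1)) + 1 / of_nat p - 1) / of_nat (n * (p - 1))"

text \<open>Used only for \<^prop>\<open>7 \<le> p\<close>, \<^prop>\<open>1 \<le> n\<close> and \<^prop>\<open>d \<in> {2, 4}\<close>, where the subtraction of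
  natural numbers does not truncate.\<close>

definition div_bernoulli_shift :: "nat \<Rightarrow> nat \<Rightarrow> nat \<Rightarrow> rat" where
  "div_bernoulli_shift p n d =
     bernoulli (n * (p - 1) - d) / of_nat (n * (p - 1) - d)"

text \<open>For \<open>p\<close> prime this is the intersection of the rationals with the ring of \<open>p\<close>-adic integers:
  \<^const>\<open>quotient_of\<close> gives the reduced fraction.\<close>

definition p_integral :: "nat \<Rightarrow> rat set" where
  "p_integral p = {x. \<not> int p dvd snd (quotient_of x)}"

text \<open>Congruence modulo \<open>p ^ k\<close> of rational \<open>p\<close>-adic integers. Since the difference is rational, it lies
  in \<open>p ^ k\<close> times the \<open>p\<close>-adic integers iff the cofactor is in \<^term>\<open>p_integral p\<close>.\<close>

definition p_cong :: "nat \<Rightarrow> nat \<Rightarrow> rat \<Rightarrow> rat \<Rightarrow> bool" where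
  "p_cong p k a b \<longleftrightarrow>
     a \<in> p_integral p \<and> b \<in> p_integral p \<and> (\<exists>c \<in> p_integral p. a - b = of_nat p ^ k * c)"

end

theory Submission
  imports Defs
begin

text \<open>
  Write \<open>S\<^sub>m\<close> for the sum of \<open>a ^ m\<close> over \<open>1 \<le> a < p\<close>. Expanding
  \<open>(p * q\<^sub>p(a)) ^ n = (a ^ (p - 1) - 1) ^ n\<close> by the binomial theorem and summing over \<open>a\<close> shows
  that \<open>p ^ (n - 1) * Q\<^sub>p(n) / n\<close> is the forward difference of order \<open>n - 1\<close>, at \<open>k = 1\<close>, of the
  numbers \<open>(S\<^bsub>k(p - 1)\<^esub> - (p - 1)) / (p * k)\<close> (\<open>fermat_quotient_sum_power_sum_quotients\<close>). By the
  Bernoulli-Faulhaber formula,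
  \<open>S\<^sub>m = p * B\<^sub>m + (m choose 2) * B\<^bsub>m - 2\<^esub> * p ^ 3 / 3 + (m choose 4) * B\<^bsub>m - 4\<^esub> * p ^ 5 / 5 + \<dots>\<close>,
  and for \<open>m = k * (p - 1)\<close> the divided Bernoulli numbers absorb every denominator: modulo \<open>p ^ 6\<close>
  (or \<open>p ^ 5\<close> for \<open>p = 7\<close>) the \<open>k\<close>-th number is \<open>p - 1\<close> times the first divided Bernoulli number
  plus multiples of the two shifted ones, with coefficients that are polynomials in \<open>p\<close>
  (\<open>power_sum_quotient_expansion\<close>, \<open>G_expansions\<close>). For \<open>n = 1\<close> this is already the claim.

  For larger \<open>n\<close> the coefficients in the claim have been simplified by Kummer's congruences: as a
  function of \<open>k\<close>, the \<open>j\<close>-th difference of \<open>B\<^sub>m / m\<close> with \<open>m = k * (p - 1) - d\<close> is divisible by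
  \<open>p ^ j\<close>, as long as this is at most \<open>p ^ (m - 1)\<close> for the smallest \<open>m\<close>, beyond which the missing
  Euler factor \<open>1 - p ^ (m - 1)\<close> is felt (\<open>kummer_congruences\<close>). The proof rests on the generating
  function \<open>1 / (1 + exp t)\<close> of \<open>(1 - 2 ^ m) * B\<^sub>m / m\<close>. It has no pole at \<open>t = 0\<close>, so these
  numbers are congruent modulo \<open>p ^ N\<close>, up to a factor 2, to the alternating sum of the
  \<open>a ^ (m - 1)\<close> over \<open>a < p ^ N\<close>. In this sum each \<open>a\<close> prime to \<open>p\<close> contributes a multiple of
  \<open>(a ^ (p - 1)) ^ k = (1 + p * v) ^ k\<close>, whose binomial expansion exhibits the divisibility. The
  factor \<open>1 - 2 ^ m\<close> is a unit, because \<open>2 ^ d\<close> is not congruent to 1 modulo \<open>p\<close> for \<open>d \<in> {2, 4}\<close>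
  and \<open>p \<ge> 7\<close>.

  After writing the shifted Bernoulli numbers in terms of their differences, each congruence is a
  polynomial identity. In the two cases \<open>n = 5\<close> modulo \<open>p ^ 5\<close> and \<open>n = 6\<close> modulo \<open>p ^ 6\<close> the
  claim moreover replaces the factor \<open>p - 1\<close> of the leading difference by \<open>- 1\<close>; this is allowed
  because the left-hand side is divisible by \<open>p ^ (n - 1)\<close>, hence so is that difference.
\<close>

section \<open>The ring of p-integral rational numbers\<close>

lemma p_integral_iff:
  assumes "prime p"
  shows "x \<in> p_integral p \<longleftrightarrow> (\<exists>a b. x = of_int a / of_int b \<and> \<not> int p dvd b)"
proof
  assume "x \<in> p_integral p"
  then have "\<not> int p dvd snd (quotient_of x)"
    by (simp add: p_integral_def)
  moreover have "x = of_int (fst (quotient_of x)) / of_int (snd (quotient_of x))"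
    by (simp add: quotient_of_div)
  ultimately show "\<exists>a b. x = of_int a / of_int b \<and> \<not> int p dvd b"
    by blast
next
  assume "\<exists>a b. x = of_int a / of_int b \<and> \<not> int p dvd b"
  then obtain a b where x: "x = of_int a / of_int b" and b: "\<not> int p dvd b"
    by blast
  define n d where "n = fst (quotient_of x)" and "d = snd (quotient_of x)"
  have d: "d > 0" "coprime n d" "x = of_int n / of_int d"
    using quotient_of_denom_pos'[of x] quotient_of_coprime[of x n d] quotient_of_div[of x n d]
    by (simp_all add: n_def d_def)
  have "b \<noteq> 0"
    using b by auto
  then have "(of_int n :: rat) * of_int b = of_int a * of_int d"
    using d x by (simp add: field_simps)
  then have "n * b = a * d"
    by (metis of_int_eq_iff of_int_mult)
  then have "d dvd b"
    using d(2) by (metis coprime_commute coprime_dvd_mult_right_iff dvd_triv_right)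
  then have "\<not> int p dvd d"
    using b dvd_trans by blast
  then show "x \<in> p_integral p"
    by (simp add: p_integral_def d_def)
qed

lemma p_integral_of_int [simp]: "prime p \<Longrightarrow> of_int a \<in> p_integral p"
  using p_integral_iff[of p "of_int a"] not_prime_unit[of "int p"]
  by (metis div_by_1 of_int_1 prime_nat_int_transfer)

lemma p_integral_of_nat [simp]: "prime p \<Longrightarrow> of_nat a \<in> p_integral p"
  using p_integral_of_int[of p "int a"] by simp

lemma p_integral_0 [simp]: "prime p \<Longrightarrow> 0 \<in> p_integral p"
  using p_integral_of_int[of p 0] by simp

lemma p_integral_1 [simp]: "prime p \<Longrightarrow> 1 \<in> p_integral p"
  using p_integral_of_int[of p 1] by simp

lemma p_integral_numeral [simp]: "prime p \<Longrightarrow> numeral w \<in> p_integral p"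
  using p_integral_of_int[of p "numeral w"] by simp

lemma p_integral_mult:
  assumes "prime p" "x \<in> p_integral p" "y \<in> p_integral p"
  shows "x * y \<in> p_integral p"
proof -
  obtain a b c d where "x = of_int a / of_int b" "\<not> int p dvd b"
    "y = of_int c / of_int d" "\<not> int p dvd d"
    using assms by (auto simp: p_integral_iff)
  then have "x * y = of_int (a * c) / of_int (b * d)" "\<not> int p dvd b * d"
    using assms(1) by (auto simp: prime_dvd_mult_iff)
  then show ?thesis
    using assms(1) p_integral_iff by blast
qed

lemma p_integral_add:
  assumes "prime p" "x \<in> p_integral p" "y \<in> p_integral p"
  shows "x + y \<in> p_integral p"
proof -
  obtain a b c d where xy: "x = of_int a / of_int b" "\<not> int p dvd b"
    "y = of_int c / of_int d" "\<not> int p dvd d"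
    using assms by (auto simp: p_integral_iff)
  then have "b \<noteq> 0" "d \<noteq> 0"
    by auto
  then have "x + y = of_int (a * d + c * b) / of_int (b * d)" 
    using xy by (simp add: field_simps)
  moreover have "\<not> int p dvd b * d"
    using xy assms(1) by (auto simp: prime_dvd_mult_iff)
  ultimately show ?thesis
    using assms(1) p_integral_iff by blast
qed

lemma p_integral_uminus: "prime p \<Longrightarrow> x \<in> p_integral p \<Longrightarrow> - x \<in> p_integral p"
  using p_integral_mult[of p "-1" x] p_integral_of_int[of p "-1"] by simp

lemma p_integral_diff:
  "prime p \<Longrightarrow> x \<in> p_integral p \<Longrightarrow> y \<in> p_integral p \<Longrightarrow> x - y \<in> p_integral p"
  using p_integral_add[of p x "- y"] p_integral_uminus[of p y] by simp

lemma p_integral_power: "prime p \<Longrightarrow> x \<in> p_integral p \<Longrightarrow> x ^ n \<in> p_integral p"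
  by (induction n) (auto intro: p_integral_mult)

lemma p_integral_sum:
  "prime p \<Longrightarrow> (\<And>i. i \<in> I \<Longrightarrow> f i \<in> p_integral p) \<Longrightarrow> sum f I \<in> p_integral p"
  by (induction I rule: infinite_finite_induct) (auto intro: p_integral_add)

lemma p_integral_divide_unit:
  assumes "prime p" "x \<in> p_integral p" "\<not> int p dvd n"
  shows "x / of_int n \<in> p_integral p"
proof -
  have "1 / of_int n \<in> p_integral p"
    using assms p_integral_iff[of p "1 / of_int n"] by (metis of_int_1)
  then show ?thesis
    using p_integral_mult[of p x "1 / of_int n"] assms by simp
qed

lemma p_integral_cancel_unit:
  assumes "prime p" "of_int n * x \<in> p_integral p" "\<not> int p dvd n"
  shows "x \<in> p_integral p"
proof -
  have "n \<noteq> 0"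
    using assms(3) by auto
  then show ?thesis
    using p_integral_divide_unit[OF assms] by simp
qed

text \<open>The primes at least 7 are those prime to 120, and 120 is a common denominator of all
  coefficients that occur in the congruences.\<close>

lemma p_integral_divide_numeral:
  assumes "prime p" "7 \<le> p" "x \<in> p_integral p" "numeral w dvd (120 :: nat)"
  shows "x / numeral w \<in> p_integral p"
proof -
  have "\<not> p dvd 120"
  proof
    assume "p dvd 120"
    then have "p dvd 2 * 2 * 2 * 3 * 5"
      by simp
    then have "p dvd 2 \<or> p dvd 3 \<or> p dvd 5"
      using assms(1) by (metis prime_dvd_mult_iff)
    then show False
      using assms(2) by (auto dest!: dvd_imp_le)
  qed
  then have "\<not> p dvd numeral w"
    using assms(4) dvd_trans by blast
  then have "\<not> int p dvd numeral w"
    by (metis of_nat_dvd_iff of_nat_numeral)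
  then show ?thesis
    using p_integral_divide_unit[OF assms(1,3), of "numeral w"] by simp
qed



text \<open>The exponent of \<open>p\<close> in \<open>n\<close> is at most \<open>l\<close> for reasons of size. This is how the denominators
  \<open>j + 1\<close> in the Bernoulli-Faulhaber formula are controlled.\<close>

lemma p_integral_prime_power_divide:
  assumes "prime p" "0 < n" "n < p ^ Suc l"
  shows "of_nat p ^ l / of_nat n \<in> p_integral p"
proof -
  define v where "v = multiplicity p n"
  obtain u where u: "n = p ^ v * u" "\<not> p dvd u"
    using assms multiplicity_decompose'[of n p] unfolding v_def
    by (metis gr_implies_not0 not_prime_unit)
  have "p ^ v \<le> n"
    using u assms by (intro dvd_imp_le) auto
  then have "p ^ v < p ^ Suc l"
    using assms by linarith
  then have "v < Suc l"
    using assms(1) by (metis power_less_imp_less_exp prime_gt_1_nat)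
  then have l: "l = v + (l - v)"
    by simp
  have "of_nat p ^ l / (of_nat n :: rat) = of_nat p ^ (l - v) / of_int (int u)"
    using u assms by (subst l, subst power_add) (simp add: prime_gt_0_nat)
  moreover have "\<dots> \<in> p_integral p"
    using assms u(2) by (intro p_integral_divide_unit p_integral_power) auto
  ultimately show ?thesis
    by metis
qed

lemmas p_integral_intros = p_integral_add p_integral_diff p_integral_uminus p_integral_mult
  p_integral_power p_integral_sum p_integral_0 p_integral_1 p_integral_numeral
  p_integral_of_int p_integral_of_nat

section \<open>Bernoulli numbers and power sums\<close>

abbreviation bernoulli_fps :: "rat fps" where
  "bernoulli_fps \<equiv> Abs_fps (\<lambda>n. bernoulli n / fact n)"

lemma fps_exp_minus_1_neq_0: "fps_exp (1 :: rat) - 1 \<noteq> 0"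
  by simp

lemma bernoulli_0 [simp]: "bernoulli 0 = 1"
proof -
  have "fps_nth (bernoulli_fps * (fps_exp 1 - 1)) 1 = fps_nth fps_X 1"
    by (simp only: bernoulli_egf)
  then show ?thesis
    by (simp add: fps_mult_nth)
qed

text \<open>Since \<open>t / (exp t - 1) + t = - t / (exp (- t) - 1)\<close>, the series changes only in its linear
  coefficient under \<open>t \<mapsto> - t\<close>.\<close>

lemma bernoulli_odd_eq_0:
  assumes "odd n" "n \<noteq> 1"
  shows "bernoulli n = 0"
proof -
  define G where "G = Abs_fps (\<lambda>n. (-1) ^ n * (bernoulli n / fact n) :: rat)"
  have G: "G = bernoulli_fps oo (fps_const (-1) * fps_X)"
    by (subst fps_compose_linear) (simp add: G_def)
  have "G * (fps_exp (-1) - 1) = (bernoulli_fps * (fps_exp 1 - 1)) oo (fps_const (-1) * fps_X)"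
    by (simp only: G fps_compose_mult_distrib fps_compose_sub_distrib fps_exp_compose_linear)
       (simp add: fps_compose_mult_distrib fps_compose_sub_distrib)
  also have "\<dots> = - fps_X"
    unfolding bernoulli_egf by (simp add: fps_eq_iff)
  finally have "G * (fps_exp (-1) - 1) * fps_exp 1 = - fps_X * fps_exp 1"
    by simp
  moreover have "fps_exp (-1) * fps_exp 1 = (1 :: rat fps)"
    using fps_exp_add_mult[of "-1 :: rat" 1] by simp
  ultimately have "G * (fps_exp 1 - 1) = fps_X * fps_exp 1"
    by (simp add: algebra_simps)
  also have "\<dots> = (bernoulli_fps + fps_X) * (fps_exp 1 - 1)"
    using bernoulli_egf by (simp add: algebra_simps)
  finally have "G = bernoulli_fps + fps_X"
    using fps_exp_minus_1_neq_0 by (metis mult_right_cancel)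
  then have "fps_nth G n = fps_nth (bernoulli_fps + fps_X) n"
    by simp
  then show ?thesis
    using assms by (simp add: G_def)
qed

text \<open>The Bernoulli-Faulhaber formula: multiply the geometric sum
  \<open>(exp (M * t) - 1) / (exp t - 1)\<close> by \<open>t\<close> and compare coefficients.\<close>

lemma power_sum_bernoulli:
  "(\<Sum>a<M. of_nat a ^ m) =
     (\<Sum>j\<le>m. of_nat (m choose j) * bernoulli (m - j) * of_nat M ^ Suc j / of_nat (Suc j))"
proof -
  define S where "S = (\<Sum>a<M. fps_exp (of_nat a :: rat))"
  have S: "S * (fps_exp 1 - 1) = fps_exp (of_nat M) - 1"
    using power_diff_1_eq[of "fps_exp (1 :: rat)" M]
    by (simp add: S_def fps_exp_power_mult mult.commute)
  have "fps_X * S = bernoulli_fps * (fps_exp 1 - 1) * S"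
    by (simp only: bernoulli_egf)
  also have "\<dots> = S * (fps_exp 1 - 1) * bernoulli_fps"
    by (simp only: ac_simps)
  finally have "fps_X * S = (fps_exp (of_nat M) - 1) * bernoulli_fps"
    by (simp only: S)
  moreover have "fps_nth (fps_X * S) (Suc m) = (\<Sum>a<M. of_nat a ^ m / fact m)"
    by (simp add: S_def fps_sum_nth)
  moreover have "fps_nth ((fps_exp (of_nat M) - 1) * bernoulli_fps) (Suc m) =
      (\<Sum>j\<le>m. of_nat M ^ Suc j / fact (Suc j) * (bernoulli (m - j) / fact (m - j)))"
    unfolding fps_mult_nth sum.atLeast0_atMost_Suc_shift by (simp add: atMost_atLeast0)
  ultimately have "(\<Sum>a<M. of_nat a ^ m) =
      fact m * (\<Sum>j\<le>m. of_nat M ^ Suc j / fact (Suc j) * (bernoulli (m - j) / fact (m - j)) :: rat)"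
    by (simp flip: sum_divide_distrib)
  also have "\<dots> =
      (\<Sum>j\<le>m. of_nat (m choose j) * bernoulli (m - j) * of_nat M ^ Suc j / of_nat (Suc j))"
    unfolding sum_distrib_left
    by (rule sum.cong) (simp_all add: binomial_fact mult_ac del: of_nat_Suc power_Suc)
  finally show ?thesis .
qed

text \<open>With the Euler polynomials \<open>E\<^sub>r\<close> given by
  \<open>2 * exp (x * t) / (exp t + 1) = (\<Sum>r. E\<^sub>r x * t ^ r / r!)\<close>, this is \<open>E\<^sub>r 0 / 2\<close>.\<close>

definition half_euler :: "nat \<Rightarrow> rat" where
  "half_euler r = (1 - 2 ^ Suc r) * bernoulli (Suc r) / of_nat (Suc r)"

text \<open>The partial fraction \<open>1 / (x + 1) = 1 / (x - 1) - 2 / (x\<^sup>2 - 1)\<close> at \<open>x = exp t\<close>.\<close>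

lemma half_euler_egf: "Abs_fps (\<lambda>r. half_euler r / fact r) * (1 + fps_exp 1) = 1"
proof -
  define H where "H = Abs_fps (\<lambda>r. half_euler r / fact r)"
  define B2 where "B2 = Abs_fps (\<lambda>n. 2 ^ n * (bernoulli n / fact n) :: rat)"
  let ?E = "fps_exp (1 :: rat)"
  have "B2 = bernoulli_fps oo (fps_const 2 * fps_X)"
    by (subst fps_compose_linear) (simp add: B2_def)
  then have "B2 * (fps_exp 2 - 1) = (bernoulli_fps * (?E - 1)) oo (fps_const 2 * fps_X)"
    by (simp add: fps_compose_mult_distrib fps_compose_sub_distrib)
  also have "\<dots> = 2 * fps_X"
    unfolding bernoulli_egf by (simp add: numeral_fps_const)
  finally have B2: "B2 * ((?E - 1) * (?E + 1)) = 2 * fps_X"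
    using fps_exp_add_mult[of "1 :: rat" 1] by (simp add: algebra_simps)
  have "fps_X * H = bernoulli_fps - B2"
  proof (rule fps_ext)
    fix n
    show "fps_nth (fps_X * H) n = fps_nth (bernoulli_fps - B2) n"
      by (cases n) (simp_all add: H_def B2_def half_euler_def diff_divide_distrib
          left_diff_distrib right_diff_distrib mult.commute)
  qed
  then have "fps_X * H * ((?E - 1) * (?E + 1)) = (bernoulli_fps * (?E - 1)) * (?E + 1) - 2 * fps_X"
    using B2 by (simp add: left_diff_distrib mult.assoc)
  also have "\<dots> = fps_X * (?E - 1)"
    unfolding bernoulli_egf by (simp add: algebra_simps)
  finally have "(fps_X * (?E - 1)) * (H * (1 + ?E)) = (fps_X * (?E - 1)) * 1"
    by (simp add: ac_simps)
  then show ?thesis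
    unfolding H_def using fps_exp_minus_1_neq_0 by (metis fps_X_neq_zero mult_left_cancel no_zero_divisors)
qed

text \<open>For odd \<open>M\<close> the sum of \<open>(- exp t) ^ a\<close> over \<open>a < M\<close> is \<open>(1 + exp (M * t)) / (1 + exp t)\<close>.\<close>

lemma alternating_power_sum:
  assumes "odd M"
  shows "(\<Sum>a<M. (-1) ^ a * of_nat a ^ r) =
    half_euler r + (\<Sum>i\<le>r. of_nat (r choose i) * half_euler i * of_nat M ^ (r - i))"
proof -
  define H where "H = Abs_fps (\<lambda>r. half_euler r / fact r)"
  define S where "S = (\<Sum>a<M. fps_const ((-1) ^ a) * fps_exp (of_nat a :: rat))"
  let ?E = "fps_exp (1 :: rat)"
  have "S = (\<Sum>a<M. (- ?E) ^ a)"
    unfolding S_def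
  proof (rule sum.cong)
    fix a
    show "fps_const ((-1) ^ a) * fps_exp (of_nat a :: rat) = (- ?E) ^ a"
      by (cases "even a") (simp_all add: fps_exp_power_mult fps_eq_iff)
  qed simp
  then have "S * (1 + ?E) = 1 + fps_exp (of_nat M)"
    using one_diff_power_eq[of "- ?E" M] assms by (simp add: fps_exp_power_mult algebra_simps)
  then have *: "S * (H * (1 + ?E)) = H * (1 + fps_exp (of_nat M))"
    by (simp only: mult.left_commute)
  have "H * (1 + ?E) = 1"
    unfolding H_def by (rule half_euler_egf)
  with * have "S = H * (1 + fps_exp (of_nat M))"
    by simp
  then have "S = H + H * fps_exp (of_nat M)"
    by (simp add: distrib_left)
  moreover have "fps_nth S r = (\<Sum>a<M. (-1) ^ a * of_nat a ^ r / fact r)"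
    by (simp add: S_def fps_sum_nth fps_mult_left_const_nth)
  moreover have "fps_nth (H + H * fps_exp (of_nat M)) r =
      half_euler r / fact r + (\<Sum>i\<le>r. half_euler i / fact i * (of_nat M ^ (r - i) / fact (r - i)))"
    by (simp add: H_def fps_mult_nth atMost_atLeast0)
  ultimately have "(\<Sum>a<M. (-1) ^ a * of_nat a ^ r) =
      half_euler r + fact r * (\<Sum>i\<le>r. half_euler i / fact i * (of_nat M ^ (r - i) / fact (r - i)))"
    by (simp add: field_simps flip: sum_divide_distrib)
  also have "fact r * (\<Sum>i\<le>r. half_euler i / fact i * (of_nat M ^ (r - i) / fact (r - i))) =
      (\<Sum>i\<le>r. of_nat (r choose i) * half_euler i * of_nat M ^ (r - i))"
    unfolding sum_distrib_left by (rule sum.cong) (simp_all add: binomial_fact mult_ac)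
  finally show ?thesis .
qed

text \<open>The formula for alternating sums with \<open>M = 1\<close>, where the only term is \<open>0 ^ r\<close>. No other
  prime than 2 has to be inverted in solving for \<open>half_euler r\<close>.\<close>

lemma half_euler_recurrence:
  "2 * half_euler r = (if r = 0 then 1 else 0) - (\<Sum>i<r. of_nat (r choose i) * half_euler i)"
  using alternating_power_sum[of 1 r]
  by (cases "r = 0") (simp_all add: power_0_left algebra_simps flip: lessThan_Suc_atMost)

lemma half_euler_p_integral:
  assumes "prime p" "odd p"
  shows "half_euler r \<in> p_integral p"
proof (induction r rule: less_induct)
  case (less r)
  have "\<not> int p dvd 2"
    using assms by (metis dvd_triv_left even_of_nat_iff int_dvd_int_iff of_nat_numeral
        primes_dvd_imp_eq two_is_prime_nat)
  moreover have "of_int 2 * half_euler r \<in> p_integral p"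
    using half_euler_recurrence[of r] less assms(1)
    by (auto intro!: p_integral_intros)
  ultimately show ?case
    using assms(1) p_integral_cancel_unit by blast
qed

lemma alternating_power_sum_cong:
  assumes "prime p" "odd p"
  shows "\<exists>c\<in>p_integral p. of_int (\<Sum>a<p ^ N. (-1) ^ a * int a ^ r) = 2 * half_euler r + of_nat p ^ N * c"
proof -
  define c :: rat where
    "c = (\<Sum>i<r. of_nat (r choose i) * half_euler i * of_nat (p ^ N) ^ (r - Suc i))"
  have "of_nat (r choose i) * half_euler i * of_nat (p ^ N) ^ (r - i) =
      of_nat (p ^ N) * (of_nat (r choose i) * half_euler i * of_nat (p ^ N) ^ (r - Suc i))"
    if "i < r" for i
  proof -
    have "r - i = Suc (r - Suc i)"
      using that by simp
    then show ?thesis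
      by simp
  qed
  then have "(\<Sum>i<r. of_nat (r choose i) * half_euler i * of_nat (p ^ N) ^ (r - i)) =
      of_nat (p ^ N) * c"
    unfolding c_def sum_distrib_left by (intro sum.cong) auto
  then have "of_int (\<Sum>a<p ^ N. (-1) ^ a * int a ^ r) = 2 * half_euler r + of_nat p ^ N * c"
    using alternating_power_sum[of "p ^ N" r] assms
    by (simp flip: lessThan_Suc_atMost)
  moreover have "c \<in> p_integral p"
    using assms half_euler_p_integral[OF assms] by (auto simp: c_def intro!: p_integral_intros)
  ultimately show ?thesis
    by blast
qed

text \<open>A form of the theorem of Adams: \<open>B\<^sub>m / m\<close> can only have denominators at primes dividing
  \<open>2 ^ m - 1\<close> or 2.\<close>

lemma divided_bernoulli_p_integral:
  assumes "prime p" "odd p" "0 < m" "\<not> int p dvd 2 ^ m - 1"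
  shows "bernoulli m / of_nat m \<in> p_integral p"
proof -
  have "of_int (2 ^ m - 1) * (bernoulli m / of_nat m) = - half_euler (m - 1)"
    using assms(3) by (simp add: half_euler_def algebra_simps diff_divide_distrib)
  then have "of_int (2 ^ m - 1) * (bernoulli m / of_nat m) \<in> p_integral p"
    using assms by (simp only:) (intro p_integral_uminus half_euler_p_integral)
  then show ?thesis
    using assms p_integral_cancel_unit by blast
qed

section \<open>Kummer congruences\<close>

text \<open>Linear combinations of the functions \<open>k \<mapsto> u ^ k\<close> with \<open>u \<equiv> 1\<close> modulo \<open>p\<close>. They form a ring,
  and by the binomial theorem their \<open>j\<close>-th differences are divisible by \<open>p ^ j\<close>.\<close>

inductive exponential_sum :: "nat \<Rightarrow> (nat \<Rightarrow> int) \<Rightarrow> bool" for p where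
  single: "exponential_sum p (\<lambda>k. c * (1 + int p * v) ^ k)"
| add: "exponential_sum p f \<Longrightarrow> exponential_sum p g \<Longrightarrow> exponential_sum p (\<lambda>k. f k + g k)"

lemma exponential_sum_const: "exponential_sum p (\<lambda>k. c)"
  using exponential_sum.single[of p c 0] by simp

lemma exponential_sum_mult:
  assumes "exponential_sum p f" "exponential_sum p g"
  shows "exponential_sum p (\<lambda>k. f k * g k)"
  using assms(1)
proof induction
  case (single c v)
  show ?case
    using assms(2)
  proof induction
    case (single d w)
    have "c * (1 + int p * v) ^ k * (d * (1 + int p * w) ^ k) =
        c * d * (1 + int p * (v + w + int p * v * w)) ^ k" for k
    proof -
      have "1 + int p * (v + w + int p * v * w) = (1 + int p * v) * (1 + int p * w)"
        by (simp add: algebra_simps)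
      then show ?thesis
        by (simp add: power_mult_distrib)
    qed
    then show ?case
      by (simp only: exponential_sum.single)
  qed (simp add: distrib_left exponential_sum.add)
qed (simp add: distrib_right exponential_sum.add)

lemma exponential_sum_power: "exponential_sum p f \<Longrightarrow> exponential_sum p (\<lambda>k. f k ^ n)"
  by (induction n) (auto intro: exponential_sum_const exponential_sum_mult)

lemma exponential_sum_sum:
  "(\<And>i. i \<in> I \<Longrightarrow> exponential_sum p (f i)) \<Longrightarrow> exponential_sum p (\<lambda>k. \<Sum>i\<in>I. f i k)"
  by (induction I rule: infinite_finite_induct)
     (auto intro: exponential_sum_const exponential_sum.add)

lemma fermat_exponential_sum:
  assumes "prime p" "\<not> p dvd a"
  shows "exponential_sum p (\<lambda>k. c * int a ^ (k * (p - 1)))"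
proof -
  have "[int a ^ (p - 1) = 1] (mod int p)"
    using fermat_theorem[OF assms] by (metis cong_int_iff of_nat_1 of_nat_power)
  then have "int p dvd int a ^ (p - 1) - 1"
    by (simp add: cong_iff_dvd_diff)
  then obtain v where "int a ^ (p - 1) - 1 = int p * v"
    by (elim dvdE)
  then have "int a ^ (p - 1) = 1 + int p * v"
    by simp
  then have "c * int a ^ (k * (p - 1)) = c * (1 + int p * v) ^ k" for k
    by (metis mult.commute power_mult)
  then show ?thesis
    by (simp only: exponential_sum.single)
qed

lemma exponential_sum_newton:
  assumes "exponential_sum p f"
  shows "\<exists>e. \<forall>k. int p ^ N dvd f k - (\<Sum>j<N. int (k choose j) * int p ^ j * e j)"
proof -
  have "\<exists>e. \<forall>k. f k = (\<Sum>j\<le>k. int (k choose j) * int p ^ j * e j)"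
    using assms
  proof induction
    case (single c v)
    have "c * (1 + int p * v) ^ k = (\<Sum>j\<le>k. int (k choose j) * int p ^ j * (c * v ^ j))" for k
      using binomial_ring[of "int p * v" 1 k]
      by (simp add: sum_distrib_left power_mult_distrib mult_ac add.commute)
    then show ?case
      by (intro exI[of _ "\<lambda>j. c * v ^ j"]) blast
  next
    case (add f g)
    then obtain e e' where
      "\<forall>k. f k = (\<Sum>j\<le>k. int (k choose j) * int p ^ j * e j)"
      "\<forall>k. g k = (\<Sum>j\<le>k. int (k choose j) * int p ^ j * e' j)"
      by blast
    then show ?case
      by (intro exI[of _ "\<lambda>j. e j + e' j"]) (simp add: distrib_left sum.distrib)
  qed
  then obtain e where e: "\<And>k. f k = (\<Sum>j\<le>k. int (k choose j) * int p ^ j * e j)"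
    by blast
  have "int p ^ N dvd f k - (\<Sum>j<N. int (k choose j) * int p ^ j * e j)" for k
  proof -
    have "f k = (\<Sum>j<N + Suc k. int (k choose j) * int p ^ j * e j)"
      unfolding e by (rule sum.mono_neutral_left) auto
    also have "\<dots> = (\<Sum>j<N. int (k choose j) * int p ^ j * e j) +
        (\<Sum>j=N..<N + Suc k. int (k choose j) * int p ^ j * e j)"
      by (simp add: sum.atLeastLessThan_concat lessThan_atLeast0 del: add_Suc_right sum.op_ivl_Suc)
    finally have "f k - (\<Sum>j<N. int (k choose j) * int p ^ j * e j) =
        (\<Sum>j=N..<N + Suc k. int (k choose j) * int p ^ j * e j)"
      by simp
    also have "int p ^ N dvd \<dots>"
      by (intro dvd_sum dvd_mult2 dvd_mult le_imp_power_dvd) auto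
    finally show ?thesis .
  qed
  then show ?thesis
    by blast
qed

text \<open>Let \<open>M = m + k * (p - 1)\<close>. Modulo \<open>p ^ N\<close>, the number \<open>2 * (1 - 2 ^ M) * B\<^sub>M / M\<close> is the
  alternating power sum over \<open>a < p ^ N\<close> of exponent \<open>M - 1\<close>. The terms with \<open>p\<close> dividing \<open>a\<close>
  vanish because \<open>N < m\<close>, and the others form an exponential sum in \<open>k\<close>. So does
  \<open>2 * (2 ^ M - 1)\<close>; its inverse modulo \<open>p ^ N\<close> is a power of it by Euler's theorem, hence also an
  exponential sum.\<close>

lemma kummer_expansion:
  assumes "prime p" "odd p" "N < m" "\<not> int p dvd 2 ^ m - 1"
  shows "\<exists>e r. (\<forall>j. e j \<in> p_integral p) \<and> (\<forall>k. r k \<in> p_integral p) \<and>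
    (\<forall>k. bernoulli (m + k * (p - 1)) / of_nat (m + k * (p - 1)) =
      (\<Sum>j<N. of_nat (k choose j) * of_nat p ^ j * e j) + of_nat p ^ N * r k)"
proof -
  define M where "M k = m + k * (p - 1)" for k
  define h where "h k = bernoulli (M k) / of_nat (M k)" for k
  define A where "A = {a. a < p ^ N \<and> \<not> p dvd a}"
  define T where "T k = (\<Sum>a\<in>A. (-1) ^ a * int a ^ (m - 1) * int a ^ (k * (p - 1)))" for k
  define D where "D k = 2 * (2 ^ M k - 1 :: nat)" for k
  \<comment> \<open>the inverse of \<open>D k\<close> modulo \<open>p ^ N\<close>\<close>
  define W where "W k = int (D k) ^ (totient (p ^ N) - 1)" for k
  have M: "0 < M k" for k
    using assms(3) by (simp add: M_def)
  have p2: "\<not> p dvd 2"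
    using assms(1,2) primes_dvd_imp_eq two_is_prime_nat by blast
  have D: "int (D k) = 2 * 2 ^ m * int 2 ^ (k * (p - 1)) + (-2)" for k
    by (simp add: D_def M_def power_add of_nat_diff)
  have unit: "\<not> int p dvd 2 ^ M k - 1" for k
  proof -
    have "[2 ^ (p - 1) = 1] (mod p)"
      using fermat_theorem[OF assms(1) p2] .
    then have "[int 2 ^ (p - 1) = 1] (mod int p)"
      by (metis cong_int_iff of_nat_1 of_nat_power)
    then have "[(2 ^ (p - 1)) ^ k = 1 ^ k] (mod int p)"
      by (intro cong_pow) simp
    then have "[2 ^ m * (2 ^ (p - 1)) ^ k - 1 = 2 ^ m * 1 - 1] (mod int p)"
      by (intro cong_diff cong_mult) simp_all
    then have "[2 ^ M k - 1 = 2 ^ m - 1] (mod int p)"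
      by (simp add: M_def power_add power_mult mult.commute[of k])
    then show ?thesis
      using assms(4) cong_dvd_iff by blast
  qed
  have h: "h k \<in> p_integral p" for k
    unfolding h_def using assms(1,2) M unit by (intro divided_bernoulli_p_integral)
  have T: "\<exists>y\<in>p_integral p. of_int (T k) = 2 * half_euler (M k - 1) + of_nat p ^ N * y" for k
  proof -
    have "int p ^ N dvd (-1) ^ a * int a ^ (M k - 1)" if "p dvd a" for a
    proof -
      have "N \<le> M k - 1"
        using assms(3) by (simp add: M_def)
      then have "int p ^ N dvd int p ^ (M k - 1)"
        by (rule le_imp_power_dvd)
      also have "int p ^ (M k - 1) dvd int a ^ (M k - 1)"
        using that by (intro dvd_power_same) simp
      finally show ?thesis
        by simp
    qed
    then have "int p ^ N dvd (\<Sum>a\<in>{..<p ^ N} - A. (-1) ^ a * int a ^ (M k - 1))"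
      by (intro dvd_sum) (auto simp: A_def)
    then obtain z where z: "(\<Sum>a\<in>{..<p ^ N} - A. (-1) ^ a * int a ^ (M k - 1)) = int p ^ N * z"
      by (elim dvdE)
    have "T k = (\<Sum>a\<in>A. (-1) ^ a * int a ^ (M k - 1))"
      using assms(3) by (simp add: T_def M_def mult.assoc flip: power_add)
    then have "(\<Sum>a<p ^ N. (-1) ^ a * int a ^ (M k - 1)) = int p ^ N * z + T k"
      using sum.subset_diff[of A "{..<p ^ N}" "\<lambda>a. (-1) ^ a * int a ^ (M k - 1)"] z
      by (auto simp: A_def)
    then obtain c where c: "c \<in> p_integral p"
      "of_int (int p ^ N * z + T k) = 2 * half_euler (M k - 1) + of_nat p ^ N * c"
      using alternating_power_sum_cong[OF assms(1,2), where N = N and r = "M k - 1"] by auto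
    have "of_int (T k) = 2 * half_euler (M k - 1) + of_nat p ^ N * (c - of_int z)"
      using c(2) by (simp add: algebra_simps)
    then show ?thesis
      using c(1) assms(1) by (blast intro: p_integral_intros)
  qed
  have Dh: "of_nat (D k) * h k = - 2 * half_euler (M k - 1)" for k
    using M[of k] by (simp add: D_def h_def half_euler_def of_nat_diff field_simps)
  have W: "\<exists>s. int (D k) * W k = 1 + int p ^ N * s" for k
  proof -
    have "\<not> p dvd D k"
    proof
      assume "p dvd D k"
      then have "p dvd 2 ^ M k - 1"
        using p2 assms(1) by (auto simp: D_def prime_dvd_mult_iff)
      then show False
        using unit[of k] int_dvd_int_iff[of p "2 ^ M k - 1"] by (simp add: of_nat_diff)
    qed
    then have "coprime (D k) (p ^ N)"
      using assms(1) by (meson coprime_commute coprime_power_right_iff prime_imp_coprime)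
    then have "[D k ^ totient (p ^ N) = 1] (mod p ^ N)"
      by (rule euler_theorem)
    then have "[int (D k) ^ totient (p ^ N) = 1] (mod int p ^ N)"
      by (metis cong_int_iff of_nat_1 of_nat_power)
    moreover have "0 < totient (p ^ N)"
      using assms(1) by (simp add: prime_gt_0_nat)
    then have "int (D k) ^ totient (p ^ N) = int (D k) * W k"
      unfolding W_def by (metis power_eq_if less_numeral_extra(3))
    ultimately have "int p ^ N dvd int (D k) * W k - 1"
      by (simp add: cong_iff_dvd_diff)
    then show ?thesis
      by (metis add_diff_cancel_left' diff_add_cancel dvd_def add.commute)
  qed
  have "exponential_sum p (\<lambda>k. (-1) * W k * T k)"
    unfolding W_def T_def D
    using assms(1) p2
    by (intro exponential_sum_mult exponential_sum_const exponential_sum_power exponential_sum_sum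
        exponential_sum.add fermat_exponential_sum) (auto simp: A_def)
  then obtain e where e:
    "\<And>k. int p ^ N dvd (-1) * W k * T k - (\<Sum>j<N. int (k choose j) * int p ^ j * e j)"
    using exponential_sum_newton by blast
  have "\<forall>k. \<exists>r. r \<in> p_integral p \<and>
      h k = (\<Sum>j<N. of_nat (k choose j) * of_nat p ^ j * of_int (e j)) + of_nat p ^ N * r"
  proof
    fix k
    obtain z where "(-1) * W k * T k - (\<Sum>j<N. int (k choose j) * int p ^ j * e j) = int p ^ N * z"
      using e[of k] by (elim dvdE)
    then have "(-1) * W k * T k = (\<Sum>j<N. int (k choose j) * int p ^ j * e j) + int p ^ N * z"
      by simp
    then have "of_int ((-1) * W k * T k) =
        (of_int ((\<Sum>j<N. int (k choose j) * int p ^ j * e j) + int p ^ N * z) :: rat)"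
      by (simp only:)
    then have z: "- of_int (W k) * of_int (T k) =
        (\<Sum>j<N. of_nat (k choose j) * of_nat p ^ j * of_int (e j)) + of_nat p ^ N * (of_int z :: rat)"
      by simp
    obtain s where "int (D k) * W k = 1 + int p ^ N * s"
      using W by blast
    then have "of_int (int (D k) * W k) = (of_int (1 + int p ^ N * s) :: rat)"
      by (simp only:)
    then have s: "of_nat (D k) * of_int (W k) = 1 + of_nat p ^ N * (of_int s :: rat)"
      by simp
    obtain y where y: "y \<in> p_integral p"
      "of_int (T k) = 2 * half_euler (M k - 1) + of_nat p ^ N * y"
      using T by blast
    have "- of_int (W k) * of_int (T k) = of_nat (D k) * of_int (W k) * h k - of_nat p ^ N * of_int (W k) * y"
    proof -
      have "2 * half_euler (M k - 1) = - (of_nat (D k) * h k)"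
        by (simp add: Dh)
      then show ?thesis
        unfolding y(2) by (simp add: algebra_simps)
    qed
    then have "- of_int (W k) * of_int (T k) = h k + of_nat p ^ N * (of_int s * h k - of_int (W k) * y)"
      unfolding s by (simp add: algebra_simps)
    then have "h k = (\<Sum>j<N. of_nat (k choose j) * of_nat p ^ j * of_int (e j)) +
        of_nat p ^ N * (of_int z - (of_int s * h k - of_int (W k) * y))"
      unfolding z by (simp add: algebra_simps)
    moreover have "of_int z - (of_int s * h k - of_int (W k) * y) \<in> p_integral p"
      using assms(1) h y(1) by (intro p_integral_intros)
    ultimately show "\<exists>r. r \<in> p_integral p \<and>
        h k = (\<Sum>j<N. of_nat (k choose j) * of_nat p ^ j * of_int (e j)) + of_nat p ^ N * r"
      by blast
  qed
  from choice[OF this] obtain r where "\<And>k. r k \<in> p_integral p"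
    "\<And>k. h k = (\<Sum>j<N. of_nat (k choose j) * of_nat p ^ j * of_int (e j)) + of_nat p ^ N * r k"
    by blast
  then show ?thesis
    unfolding h_def M_def using assms(1)
    by (intro exI[of _ "\<lambda>j. of_int (e j)"] exI[of _ r]) simp
qed

section \<open>Power sums over the residues, with exponents divisible by p - 1\<close>

text \<open>The weak half of the theorem of von Staudt and Clausen, by induction from the
  Bernoulli-Faulhaber formula with \<open>M = p\<close>, whose leading term is \<open>p * B\<^sub>m\<close>.\<close>

lemma prime_mult_bernoulli_p_integral:
  assumes "prime p"
  shows "of_nat p * bernoulli m \<in> p_integral p"
proof (induction m rule: less_induct)
  case (less m)
  let ?t = "\<lambda>j. of_nat (m choose j) * bernoulli (m - j) * of_nat p ^ Suc j / of_nat (Suc j)"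
  have "?t j \<in> p_integral p" if "j \<in> {..m} - {0}" for j
  proof -
    have "?t j = of_nat (m choose j) * (of_nat p * bernoulli (m - j)) * (of_nat p ^ j / of_nat (Suc j))"
      by simp
    also have "\<dots> \<in> p_integral p"
    proof -
      have "Suc j < p ^ Suc j"
        using power_gt_expt[of p "Suc j"] prime_gt_1_nat[OF assms] by simp
      moreover have "of_nat p * bernoulli (m - j) \<in> p_integral p"
        using that less by simp
      ultimately show ?thesis
        using assms
        by (intro p_integral_mult[OF assms p_integral_mult[OF assms p_integral_of_nat[OF assms]]]
            p_integral_prime_power_divide) auto
    qed
    finally show ?thesis .
  qed
  then have "(\<Sum>j\<in>{..m} - {0}. ?t j) \<in> p_integral p"
    using assms by (intro p_integral_sum)
  moreover have "of_nat p * bernoulli m = of_nat (\<Sum>a<p. a ^ m) - (\<Sum>j\<in>{..m} - {0}. ?t j)"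
    using power_sum_bernoulli[of m p] sum.remove[of "{..m}" 0 ?t] by simp
  ultimately show ?case
    using assms by (simp only:) (intro p_integral_diff p_integral_of_nat)
qed

text \<open>Here \<open>M \<equiv> - d\<close> modulo \<open>p - 1\<close>, so that \<open>p\<close> would divide \<open>2 ^ d - 1\<close>, which is 3, 15 or 63.\<close>

lemma two_power_not_cong_1:
  assumes "prime p" "M + d = k * (p - 1)" "7 \<le> p" "d \<in> {2, 4} \<or> d = 6 \<and> 11 \<le> p"
  shows "\<not> int p dvd 2 ^ M - 1"
proof
  assume *: "int p dvd 2 ^ M - 1"
  have "\<not> p dvd 2"
    using assms(3) by (auto dest!: dvd_imp_le)
  then have "[2 ^ (p - 1) = 1] (mod p)"
    using fermat_theorem assms(1) by blast
  then have "[int 2 ^ (p - 1) = 1] (mod int p)"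
    by (metis cong_int_iff of_nat_1 of_nat_power)
  then have "[(2 ^ (p - 1)) ^ k = 1 ^ k] (mod int p)"
    by (intro cong_pow) simp
  then have "int p dvd 2 ^ (M + d) - 1"
    by (simp add: assms(2) power_mult mult.commute[of k] cong_iff_dvd_diff)
  moreover have "2 ^ (M + d) - 1 = 2 ^ d * (2 ^ M - 1) + (2 ^ d - 1 :: int)"
    by (simp add: power_add algebra_simps)
  ultimately have "int p dvd 2 ^ d - 1"
    using * by (metis dvd_add_right_iff dvd_mult)
  then have "int p dvd 3 \<or> int p dvd 15 \<or> int p dvd 63 \<and> 11 \<le> p"
    using assms(4) by auto
  then have "p dvd 3 \<or> p dvd 3 * 5 \<or> p dvd 3 * 3 * 7 \<and> 11 \<le> p"
    using int_dvd_int_iff[of p 3] int_dvd_int_iff[of p 15] int_dvd_int_iff[of p 63] by auto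
  then have "p dvd 3 \<or> p dvd 5 \<or> p dvd 7 \<and> 11 \<le> p"
    using assms(1) by (metis prime_dvd_mult_iff)
  then show False
    using assms(3) by (auto dest!: dvd_imp_le)
qed

lemma div_bernoulli_shift_p_integral:
  assumes "prime p" "7 \<le> p" "1 \<le> k" "d \<in> {2, 4}"
  shows "div_bernoulli_shift p k d \<in> p_integral p"
proof -
  have "6 \<le> k * (p - 1)"
    using mult_le_mono[of 1 k 6 "p - 1"] assms by simp
  then have "k * (p - 1) - d + d = k * (p - 1)" "0 < k * (p - 1) - d"
    using assms(4) by auto
  moreover have "odd p"
    using assms(1,2) prime_odd_nat by auto
  ultimately show ?thesis
    unfolding div_bernoulli_shift_def using assms two_power_not_cong_1
    by (intro divided_bernoulli_p_integral) blast+
qed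

lemma less_prime_power:
  fixes p :: nat
  assumes "7 \<le> p" "2 \<le> n"
  shows "n + 7 < p ^ n"
  using assms(2)
proof (induction n rule: dec_induct)
  case base
  then show ?case
    using assms(1) power_mono[of 7 p 2] by simp
next
  case (step n)
  have "Suc n + 7 < 7 * p ^ n"
    using step by simp
  also have "\<dots> \<le> p ^ Suc n"
    using assms(1) by simp
  finally show ?case .
qed

text \<open>In the Bernoulli-Faulhaber formula for \<open>S\<^sub>m\<close> all terms except those with \<open>j \<in> {0, 2, 4}\<close>
  vanish modulo \<open>p ^ (e + 1)\<close>. For odd \<open>j\<close> the Bernoulli number is 0, except \<open>B\<^sub>1\<close> at \<open>j = m - 1\<close>,
  where the power of \<open>p\<close> is \<open>p ^ m\<close>. For \<open>j \<ge> 8\<close> even the crude bounds suffice: \<open>p * B\<^bsub>m - j\<^esub>\<close> is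
  \<open>p\<close>-integral and \<open>p ^ j / (j + 1)\<close> is divisible by \<open>p ^ 7\<close>. The delicate term is \<open>j = 6\<close>, with
  \<open>p ^ 7 / 7\<close>: for \<open>p \<ge> 11\<close> one needs that \<open>B\<^bsub>m - 6\<^esub>\<close> itself is \<open>p\<close>-integral; for \<open>p = 7\<close> a factor
  \<open>p\<close> is lost twice, once to the denominator 7 and once to \<open>B\<^bsub>m - 6\<^esub>\<close> (unless \<open>m = 6\<close>), and the
  binomial coefficient returns one of them.\<close>

lemma power_sum_bernoulli_tail:
  assumes "prime p" "7 \<le> p" "e = 5 \<or> e = 6 \<and> 11 \<le> p" "1 \<le> k" "k \<le> e"
    and m: "m = k * (p - 1)" and "j \<le> m" "j \<notin> {0, 2, 4}"
  shows "of_nat (m choose j) * bernoulli (m - j) * of_nat p ^ Suc j / of_nat (Suc j) / of_nat p ^ Suc e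
    \<in> p_integral p" (is "?t \<in> _")
proof -
  have p: "odd p" "(of_nat p :: rat) \<noteq> 0"
    using assms(1,2) prime_odd_nat by auto
  have em: "Suc e \<le> m"
  proof -
    have "p - 1 \<le> m"
      using assms(4) by (simp add: m)
    then show ?thesis
      using assms(2,3) by auto
  qed
  consider "odd j" "j \<noteq> m - 1" | "j = m - 1" | "j = 6" | "8 \<le> j"
  proof -
    have "j \<in> {1, 3, 5, 7} \<or> j = 6 \<or> 8 \<le> j"
      using assms(8) by auto
    then show ?thesis
      using that by fastforce
  qed
  then show ?thesis
  proof cases
    case 1
    have "even m"
      using p by (simp add: m)
    then have "bernoulli (m - j) = 0"
      using 1 assms(7) by (intro bernoulli_odd_eq_0) auto
    then show ?thesis
      using assms(1) by simp
  next
    case 2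
    have "m = Suc (m - 1)" "m = Suc e + (m - Suc e)"
      using em by simp_all
    have "?t = (bernoulli 1 / of_nat 1) * (of_nat p ^ m / of_nat p ^ Suc e)"
      using 2 em binomial_symmetric[of 1 m] by simp
    also have "\<dots> = (bernoulli 1 / of_nat 1) * of_nat p ^ (m - Suc e)"
      using em p by (simp add: power_diff del: power_Suc)
    also have "\<dots> \<in> p_integral p"
      using assms(1) p divided_bernoulli_p_integral[of p 1] not_prime_unit
      by (intro p_integral_intros) auto
    finally show ?thesis .
  next
    case 3
    show ?thesis
    proof (cases "11 \<le> p")
      case True
      define c where "c = bernoulli (m - 6) / of_nat (m - 6)"
      have "10 \<le> m"
        using mult_le_mono[of 1 k 10 "p - 1"] assms(4) True by (simp add: m)
      then have "0 < m - 6" "m - 6 + 6 = k * (p - 1)"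
        using m by simp_all
      then have c: "bernoulli (m - 6) = of_nat (m - 6) * c" "c \<in> p_integral p"
        unfolding c_def
        using divided_bernoulli_p_integral[of p "m - 6"] two_power_not_cong_1[of p "m - 6" 6 k]
          assms(1,2) p True by (simp_all del: of_nat_diff)
      have "\<not> int p dvd 7"
      proof
        assume "int p dvd 7"
        then have "int p \<le> 7"
          by (rule zdvd_imp_le) simp
        then show False
          using True by simp
      qed
      have "?t = of_nat (m choose 6) * (of_nat (m - 6) * c) * of_nat p ^ (6 - e) / of_int 7"
        using 3 c(1) p assms(3) by (auto simp: field_simps power_numeral_reduce)
      also have "\<dots> \<in> p_integral p"
        using assms(1) c(2) \<open>\<not> int p dvd 7\<close>
        by (intro p_integral_divide_unit) (auto intro!: p_integral_intros)
      finally show ?thesis .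
    next
      case False
      have "p \<noteq> 8" "p \<noteq> 9" "p \<noteq> 10"
        using assms(1) by auto
      then have p7: "p = 7"
        using False assms(2) by auto
      then have e5: "e = 5"
        using assms(3) by auto
      have t: "?t = of_nat (m choose 6) * bernoulli (m - 6)"
        using 3 by (simp add: p7 e5)
      show ?thesis
      proof (cases "k = 1")
        case True
        then show ?thesis
          unfolding t using assms(1) by (simp add: m p7)
      next
        case False
        then have "k \<in> {2, 3, 4, 5}"
          using assms(4,5) e5 by auto
        then have "\<not> 7 dvd m - 6"
          by (auto simp: m p7)
        \<comment> \<open>divisibility of the binomial coefficient by 7, without evaluating it\<close>
        moreover have "(m - 6) * (m choose 6) = 7 * (m choose 7)"
          using binomial_absorb_comp[of m 6] binomial_absorption[of 6 m] by simp
        then have "7 dvd (m - 6) * (m choose 6)"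
          by (metis dvd_triv_left)
        ultimately have "7 dvd (m choose 6)"
          using assms(1) prime_dvd_mult_iff[of 7 "m - 6" "m choose 6"] by (simp add: p7)
        then obtain u where "m choose 6 = 7 * u"
          by (elim dvdE)
        then have "?t = of_nat u * (of_nat p * bernoulli (m - 6))"
          unfolding t by (simp add: p7)
        also have "\<dots> \<in> p_integral p"
          using assms(1) by (intro p_integral_mult p_integral_of_nat prime_mult_bernoulli_p_integral)
        finally show ?thesis .
      qed
    qed
  next
    case 4
    obtain i where j: "j = i + 8"
      using 4 by (metis add.commute le_Suc_ex)
    have "Suc j = 1 + Suc i + (6 - e) + Suc e"
      using assms(3) j by auto
    then have "(of_nat p :: rat) ^ Suc j = of_nat p * of_nat p ^ Suc i * of_nat p ^ (6 - e) * of_nat p ^ Suc e"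
      by (simp only: power_add power_one_right)
    then have "?t = of_nat (m choose j) * (of_nat p * bernoulli (m - j)) *
        (of_nat p ^ Suc i / of_nat (Suc j)) * of_nat p ^ (6 - e)"
      using p by (simp del: power_Suc of_nat_Suc)
    also have "\<dots> \<in> p_integral p"
    proof -
      have "Suc j < p ^ Suc (Suc i)"
        using less_prime_power[OF assms(2), of "i + 2"] j by simp
      then show ?thesis
        using assms(1) prime_mult_bernoulli_p_integral[OF assms(1), of "m - j"]
        by (intro p_integral_mult[OF assms(1) p_integral_mult[OF assms(1) p_integral_mult]]
            p_integral_prime_power_divide p_integral_of_nat p_integral_power) auto
    qed
    finally show ?thesis .
  qed
qed

text \<open>By Fermat's little theorem the numerator is divisible by \<open>p\<close>, and the binomial theorem turns
  power sums of Fermat quotients into forward differences of this function of \<open>k\<close>.\<close>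

definition power_sum_quotient :: "nat \<Rightarrow> nat \<Rightarrow> rat" where
  "power_sum_quotient p k = of_int (\<Sum>a = 1..p - 1. int a ^ (k * (p - 1)) - 1) / of_nat (p * k)"

text \<open>The terms \<open>j = 0, 2, 4\<close> of the Bernoulli-Faulhaber formula for \<open>m = k * (p - 1)\<close>. Passing
  from \<open>B\<^bsub>m - d\<^esub>\<close> to \<open>B\<^bsub>m - d\<^esub> / (m - d)\<close> turns the binomial coefficient into a longer falling
  product divisible by \<open>m = k * (p - 1)\<close>; the constant \<open>1 / p - 1\<close> in the first divided Bernoulli
  number accounts for the subtraction of \<open>p - 1\<close>.\<close>

lemma power_sum_quotient_expansion:
  assumes "prime p" "7 \<le> p" "e = 5 \<or> e = 6 \<and> 11 \<le> p" "1 \<le> k" "k \<le> e"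
  shows "\<exists>r\<in>p_integral p. power_sum_quotient p k =
    (let P = of_nat p; m = of_nat k * (P - 1) in
      (P - 1) * div_bernoulli p k
      + P ^ 2 * ((P - 1) * (m - 1) * (m - 2) / 6) * div_bernoulli_shift p k 2
      + P ^ 4 * ((P - 1) * (m - 1) * (m - 2) * (m - 3) * (m - 4) / 120) * div_bernoulli_shift p k 4
      + P ^ e * r)"
proof -
  define P where "P = (of_nat p :: rat)"
  define n where "n = k * (p - 1)"
  define m where "m = (of_nat n :: rat)"
  let ?t = "\<lambda>j. of_nat (n choose j) * bernoulli (n - j) * P ^ Suc j / of_nat (Suc j)"
  define s where "s = (\<Sum>j\<in>{..n} - {0, 2, 4}. ?t j / P ^ Suc e)"
  have P: "P \<noteq> 0" "of_nat (p - 1) = P - 1"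
    using assms(2) by (simp_all add: P_def of_nat_diff)
  have m: "m = of_nat k * (P - 1)"
    unfolding m_def n_def of_nat_mult P(2) ..
  have n: "6 \<le> n"
    using mult_le_mono[of 1 k 6 "p - 1"] assms by (simp add: n_def)
  have "s \<in> p_integral p"
    unfolding s_def P_def
    by (intro p_integral_sum[OF assms(1)] power_sum_bernoulli_tail[OF assms n_def]) auto
  have "(\<Sum>a<p. of_nat a ^ n) = (\<Sum>j\<in>{0, 2, 4}. ?t j) + (\<Sum>j\<in>{..n} - {0, 2, 4}. ?t j)"
    unfolding power_sum_bernoulli P_def
    using n by (subst sum.subset_diff[of "{0, 2, 4}"]) (auto simp: add.commute)
  also have "(\<Sum>j\<in>{..n} - {0, 2, 4}. ?t j) = P ^ Suc e * s"
    using P(1) by (simp add: s_def sum_distrib_left mult_ac del: power_Suc of_nat_Suc)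
  also have "(\<Sum>j\<in>{0, 2, 4}. ?t j) = P * bernoulli n
      + m * (m - 1) / 2 * bernoulli (n - 2) * P ^ 3 / 3
      + m * (m - 1) * (m - 2) * (m - 3) / 24 * bernoulli (n - 4) * P ^ 5 / 5"
  proof -
    have c2: "of_nat (n choose 2) = m * (m - 1) / 2"
      and c4: "of_nat (n choose 4) = m * (m - 1) * (m - 2) * (m - 3) / 24"
      by (simp_all add: binomial_gbinomial gbinomial_prod_rev m_def fact_numeral eval_nat_numeral)
    show ?thesis
      by (simp add: power_numeral_reduce flip: c2 c4)
  qed
  finally have S: "(\<Sum>a<p. of_nat a ^ n) = P * bernoulli n
      + m * (m - 1) / 2 * bernoulli (n - 2) * P ^ 3 / 3
      + m * (m - 1) * (m - 2) * (m - 3) / 24 * bernoulli (n - 4) * P ^ 5 / 5 + P ^ Suc e * s" .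
  have "{..<p} = insert 0 {1..p - 1}"
    using assms(2) by auto
  then have "(\<Sum>a = 1..p - 1. int a ^ n - 1) = (\<Sum>a<p. int a ^ n) - int (p - 1)"
    using n by (simp add: sum_subtractf)
  then have "of_int (\<Sum>a = 1..p - 1. int a ^ n - 1) =
      (of_int ((\<Sum>a<p. int a ^ n) - int (p - 1)) :: rat)"
    by (simp only:)
  also have "\<dots> = (\<Sum>a<p. of_nat a ^ n) - (P - 1)"
    unfolding of_int_diff of_int_of_nat_eq P(2) by simp
  finally have "P * of_nat k * power_sum_quotient p k = (\<Sum>a<p. of_nat a ^ n) - (P - 1)"
    unfolding power_sum_quotient_def n_def[symmetric] using P(1) assms(4) by (simp add: P_def)
  moreover have "bernoulli n = m * div_bernoulli p k - 1 / P + 1"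
    "bernoulli (n - 2) = (m - 2) * div_bernoulli_shift p k 2"
    "bernoulli (n - 4) = (m - 4) * div_bernoulli_shift p k 4"
    unfolding div_bernoulli_def div_bernoulli_shift_def n_def[symmetric] m_def P_def[symmetric]
    using n by (simp_all add: field_simps)
  ultimately have "P * of_nat k * power_sum_quotient p k = P * (m * div_bernoulli p k)
      + m * (m - 1) / 2 * ((m - 2) * div_bernoulli_shift p k 2) * P ^ 3 / 3
      + m * (m - 1) * (m - 2) * (m - 3) / 24 * ((m - 4) * div_bernoulli_shift p k 4) * P ^ 5 / 5
      + P ^ Suc e * s"
    unfolding S using P by (simp add: algebra_simps)
  also have "\<dots> = P * of_nat k * ((P - 1) * div_bernoulli p k
      + P ^ 2 * ((P - 1) * (m - 1) * (m - 2) / 6) * div_bernoulli_shift p k 2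
      + P ^ 4 * ((P - 1) * (m - 1) * (m - 2) * (m - 3) * (m - 4) / 120) * div_bernoulli_shift p k 4
      + P ^ e * (s / of_nat k))"
  proof -
    have *: "m * x = of_nat k * ((P - 1) * x)" for x
      by (simp add: m)
    show ?thesis
      using assms(4) by (simp add: * distrib_left power_numeral_reduce) (simp add: mult_ac)
  qed
  finally have "power_sum_quotient p k = (P - 1) * div_bernoulli p k
      + P ^ 2 * ((P - 1) * (m - 1) * (m - 2) / 6) * div_bernoulli_shift p k 2
      + P ^ 4 * ((P - 1) * (m - 1) * (m - 2) * (m - 3) * (m - 4) / 120) * div_bernoulli_shift p k 4
      + P ^ e * (s / of_nat k)"
    using P assms(4) by simp
  moreover have "s / of_nat k \<in> p_integral p"
  proof -
    have "\<not> int p dvd int k"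
      using assms by (auto dest!: dvd_imp_le)
    then show ?thesis
      using p_integral_divide_unit[OF assms(1) \<open>s \<in> p_integral p\<close>, of "int k"] by simp
  qed
  ultimately show ?thesis
    unfolding Let_def P_def[symmetric] m[symmetric] by blast
qed

lemma power_sum_quotient_p_integral:
  assumes "prime p" "1 \<le> k" "k < p"
  shows "power_sum_quotient p k \<in> p_integral p"
proof -
  have "int p dvd int a ^ (k * (p - 1)) - 1" if "a \<in> {1..p - 1}" for a
  proof -
    have "\<not> p dvd a"
      using that by (auto dest: dvd_imp_le)
    then have "[int a ^ (p - 1) = 1] (mod int p)"
      using fermat_theorem[OF assms(1)] by (metis cong_int_iff of_nat_1 of_nat_power)
    then have "[(int a ^ (p - 1)) ^ k = 1 ^ k] (mod int p)"
      by (rule cong_pow)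
    then show ?thesis
      by (simp add: cong_iff_dvd_diff power_mult mult.commute[of k])
  qed
  then have "int p dvd (\<Sum>a = 1..p - 1. int a ^ (k * (p - 1)) - 1)"
    by (rule dvd_sum)
  then obtain z where z: "(\<Sum>a = 1..p - 1. int a ^ (k * (p - 1)) - 1) = int p * z"
    by (elim dvdE)
  have "power_sum_quotient p k = of_int z / of_int (int k)"
    unfolding power_sum_quotient_def z using assms(1) by (simp add: prime_gt_0_nat)
  moreover have "\<not> int p dvd int k"
    using assms by (auto dest!: dvd_imp_le)
  ultimately show ?thesis
    using p_integral_divide_unit[OF assms(1) p_integral_of_int[OF assms(1)], where n = "int k"]
    by simp
qed

text \<open>In the expansion of \<open>power_sum_quotient p k\<close> everything else is \<open>p\<close>-integral, and \<open>p - 1\<close> is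
  a unit.\<close>

lemma div_bernoulli_p_integral:
  assumes "prime p" "7 \<le> p" "e = 5 \<or> e = 6 \<and> 11 \<le> p" "1 \<le> k" "k \<le> e"
  shows "div_bernoulli p k \<in> p_integral p"
proof -
  define P where "P = (of_nat p :: rat)"
  define m where "m = of_nat k * (P - 1)"
  obtain r where r: "r \<in> p_integral p" "power_sum_quotient p k = (P - 1) * div_bernoulli p k
      + P ^ 2 * ((P - 1) * (m - 1) * (m - 2) / 6) * div_bernoulli_shift p k 2
      + P ^ 4 * ((P - 1) * (m - 1) * (m - 2) * (m - 3) * (m - 4) / 120) * div_bernoulli_shift p k 4
      + P ^ e * r"
    using power_sum_quotient_expansion[OF assms] unfolding Let_def by (auto simp: P_def m_def)
  have "of_int (int p - 1) * div_bernoulli p k = power_sum_quotient p k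
      - P ^ 2 * ((P - 1) * (m - 1) * (m - 2) / 6) * div_bernoulli_shift p k 2
      - P ^ 4 * ((P - 1) * (m - 1) * (m - 2) * (m - 3) * (m - 4) / 120) * div_bernoulli_shift p k 4
      - P ^ e * r"
    using r(2) by (simp add: P_def)
  also have "\<dots> \<in> p_integral p"
    unfolding P_def m_def using assms r(1)
    by (intro p_integral_intros p_integral_divide_numeral power_sum_quotient_p_integral
        div_bernoulli_shift_p_integral) auto
  finally have "of_int (int p - 1) * div_bernoulli p k \<in> p_integral p" .
  moreover have "\<not> int p dvd int p - 1"
    using assms(2) by (auto dest!: zdvd_imp_le)
  ultimately show ?thesis
    using p_integral_cancel_unit assms(1) by blast
qed

text \<open>The binomial expansion of \<open>(x - 1) ^ n\<close> at \<open>x = a ^ (p - 1)\<close>, in which \<open>x ^ k\<close> may be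
  replaced by \<open>x ^ k - 1\<close> because the alternating sum of the binomial coefficients is 0. Finally
  \<open>k * (n choose k) = n * ((n - 1) choose (k - 1))\<close>.\<close>

lemma fermat_quotient_sum_power_sum_quotients:
  assumes "prime p" "1 \<le> n"
  shows "of_nat p ^ (n - 1) * of_int (fermat_quotient_sum p n) / of_nat n =
    (\<Sum>k = 1..n. (-1) ^ (n - k) * of_nat ((n - 1) choose (k - 1)) * power_sum_quotient p k)"
proof -
  define F where "F = power_sum_quotient p"
  define P where "P = (of_nat p :: rat)"
  have P: "P \<noteq> 0"
    using assms(1) by (simp add: P_def prime_gt_0_nat)
  define X where "X k = (\<Sum>a = 1..p - 1. int a ^ (k * (p - 1)) - 1)" for k
  have X: "of_int (X k) = P * of_nat k * F k" for k
    using P by (cases "k = 0") (simp_all add: F_def P_def power_sum_quotient_def X_def)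
  have binom: "(x - 1) ^ n = (\<Sum>k\<le>n. int (n choose k) * (-1) ^ (n - k) * (x ^ k - 1))" for x :: int
    using binomial_ring[of x "-1" n] binomial_ring[of 1 "-1 :: int" n] assms(2)
    by (simp add: algebra_simps sum_subtractf power_0_left)
  have "int p ^ n * fermat_quotient_sum p n = (\<Sum>a = 1..p - 1. (int p * fermat_quotient p a) ^ n)"
    by (simp add: fermat_quotient_sum_def sum_distrib_left power_mult_distrib)
  also have "\<dots> = (\<Sum>a = 1..p - 1. (int a ^ (p - 1) - 1) ^ n)"
    using assms(1) by (intro sum.cong) (auto simp: fermat_quotient_exact)
  also have "\<dots> = (\<Sum>a = 1..p - 1. \<Sum>k\<le>n. int (n choose k) * (-1) ^ (n - k) *
      (int a ^ (k * (p - 1)) - 1))"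
    unfolding binom by (simp add: mult.commute flip: power_mult)
  also have "\<dots> = (\<Sum>k\<le>n. int (n choose k) * (-1) ^ (n - k) * X k)"
    unfolding X_def sum_distrib_left by (rule sum.swap)
  also have "\<dots> = (\<Sum>k = 1..n. int (n choose k) * (-1) ^ (n - k) * X k)"
    by (rule sum.mono_neutral_right) (auto simp: X_def not_less_eq_eq)
  finally have "of_int (int p ^ n * fermat_quotient_sum p n) =
      (of_int (\<Sum>k = 1..n. int (n choose k) * (-1) ^ (n - k) * X k) :: rat)"
    by (simp only:)
  then have "P ^ n * of_int (fermat_quotient_sum p n) =
      (\<Sum>k = 1..n. of_nat (n choose k) * (-1) ^ (n - k) * (P * of_nat k * F k))"
    by (simp add: X P_def)
  also have "\<dots> = (\<Sum>k = 1..n. P * of_nat n * ((-1) ^ (n - k) * of_nat ((n - 1) choose (k - 1)) * F k))"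
  proof (rule sum.cong)
    fix k
    assume "k \<in> {1..n}"
    then have "k * (n choose k) = n * ((n - 1) choose (k - 1))"
      using times_binomial_minus1_eq[of k n] by simp
    then have "of_nat (k * (n choose k)) = (of_nat (n * ((n - 1) choose (k - 1))) :: rat)"
      by (simp only:)
    then have *: "of_nat k * of_nat (n choose k) = of_nat n * (of_nat ((n - 1) choose (k - 1)) :: rat)"
      by simp
    have "of_nat (n choose k) * (-1) ^ (n - k) * (P * of_nat k * F k) =
        P * (of_nat k * of_nat (n choose k)) * ((-1) ^ (n - k) * F k)"
      by simp
    then show "of_nat (n choose k) * (-1) ^ (n - k) * (P * of_nat k * F k) =
        P * of_nat n * ((-1) ^ (n - k) * of_nat ((n - 1) choose (k - 1)) * F k)"
      unfolding * by simp
  qed simp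
  finally have "P * of_nat n * (P ^ (n - 1) * of_int (fermat_quotient_sum p n) / of_nat n) =
      P * of_nat n * (\<Sum>k = 1..n. (-1) ^ (n - k) * of_nat ((n - 1) choose (k - 1)) * F k)"
    using assms(2) by (simp add: sum_distrib_left power_eq_if)
  then show ?thesis
    using P assms(2) by (simp add: P_def F_def)
qed

section \<open>Forward differences and the congruences\<close>

text \<open>The forward difference of order \<open>n - 1\<close> of \<open>g\<close> at 1. The shift by one in the order makes the
  sum run over \<open>g 1, \<dots>, g n\<close>.\<close>

definition fwd_diff :: "nat \<Rightarrow> (nat \<Rightarrow> rat) \<Rightarrow> rat" where
  "fwd_diff n g = (\<Sum>k = 1..n. (-1) ^ (n - k) * of_nat ((n - 1) choose (k - 1)) * g k)"

lemma fwd_diff_simps: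
  "fwd_diff 1 g = g 1"
  "fwd_diff 2 g = g 2 - g 1"
  "fwd_diff 3 g = g 3 - 2 * g 2 + g 1"
  "fwd_diff 4 g = g 4 - 3 * g 3 + 3 * g 2 - g 1"
  "fwd_diff 5 g = g 5 - 4 * g 4 + 6 * g 3 - 4 * g 2 + g 1"
  "fwd_diff 6 g = g 6 - 5 * g 5 + 10 * g 4 - 10 * g 3 + 5 * g 2 - g 1"
  by (simp_all add: fwd_diff_def eval_nat_numeral)

text \<open>The coefficients of \<open>f\<close> in the basis of binomial coefficient functions, that is, its forward
  differences at 0, in the recursive form from which integrality can be read off.\<close>

fun newton_coeff :: "(nat \<Rightarrow> rat) \<Rightarrow> nat \<Rightarrow> rat" where
  "newton_coeff f k = f k - (\<Sum>j<k. of_nat (k choose j) * newton_coeff f j)"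

declare newton_coeff.simps [simp del]

lemma newton_coeff_expansion: "f k = (\<Sum>j\<le>k. of_nat (k choose j) * newton_coeff f j)"
  by (simp add: newton_coeff.simps[of f k] flip: lessThan_Suc_atMost)

lemma newton_coeff_p_integral:
  assumes "prime p" "\<And>k. f k \<in> p_integral p"
  shows "newton_coeff f k \<in> p_integral p"
proof (induction k rule: less_induct)
  case (less k)
  then show ?case
    unfolding newton_coeff.simps[of f k]
    using assms by (intro p_integral_diff p_integral_sum p_integral_mult) auto
qed

text \<open>The Kummer congruences without Euler factor, stated as divisibility of the coefficients in
  the Newton expansion. The error terms of order \<open>p ^ N\<close> in \<open>kummer_expansion\<close> are arbitrary
  functions of \<open>k\<close>, and are expanded in turn.\<close>

lemma kummer_congruences:
  assumes "prime p" "odd p" "N < m" "\<not> int p dvd 2 ^ m - 1"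
  shows "\<exists>e. (\<forall>j. e j \<in> p_integral p) \<and>
    (\<forall>k. bernoulli (m + k * (p - 1)) / of_nat (m + k * (p - 1)) =
      (\<Sum>j\<le>k. of_nat (k choose j) * of_nat p ^ min j N * e j))"
proof -
  define P where "P = (of_nat p :: rat)"
  define h where "h k = bernoulli (m + k * (p - 1)) / of_nat (m + k * (p - 1))" for k
  obtain e r where e: "\<And>j. e j \<in> p_integral p" and r: "\<And>k. r k \<in> p_integral p"
    and h: "\<And>k. h k = (\<Sum>j<N. of_nat (k choose j) * P ^ j * e j) + P ^ N * r k"
    using kummer_expansion[OF assms] unfolding h_def P_def by blast
  define c where "c j = (if j < N then e j + P ^ (N - j) * newton_coeff r j else newton_coeff r j)" for j
  have "c j \<in> p_integral p" for j
    unfolding c_def P_def using assms(1) e r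
    by (auto intro!: p_integral_intros newton_coeff_p_integral)
  moreover have "h k = (\<Sum>j\<le>k. of_nat (k choose j) * P ^ min j N * c j)" for k
  proof -
    have "(\<Sum>j<N. of_nat (k choose j) * P ^ j * e j) =
        (\<Sum>j\<le>k. if j < N then of_nat (k choose j) * P ^ j * e j else 0)"
      by (rule sum.mono_neutral_cong) auto
    then have "h k = (\<Sum>j\<le>k. (if j < N then of_nat (k choose j) * P ^ j * e j else 0)
        + P ^ N * (of_nat (k choose j) * newton_coeff r j))"
      unfolding h newton_coeff_expansion[of r k] by (simp add: sum.distrib sum_distrib_left)
    also have "\<dots> = (\<Sum>j\<le>k. of_nat (k choose j) * P ^ min j N * c j)"
      by (rule sum.cong) (auto simp: c_def algebra_simps min_def simp flip: power_add)
    finally show ?thesis .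
  qed
  ultimately show ?thesis
    unfolding h_def P_def by blast
qed

text \<open>The smallest index is \<open>p - 1 - d\<close>, at \<open>k = 1\<close>, and it has to exceed \<open>N\<close>.\<close>

lemma div_bernoulli_shift_newton:
  assumes "prime p" "7 \<le> p" "d \<in> {2, 4}" "N + d + 2 \<le> p"
  shows "\<exists>c. (\<forall>j. c j \<in> p_integral p) \<and> (\<forall>k\<ge>1. div_bernoulli_shift p k d =
      (\<Sum>j<k. of_nat ((k - 1) choose j) * of_nat p ^ min j N * c j))"
proof -
  have "odd p"
    using assms(1,2) prime_odd_nat by auto
  moreover have d: "p - 1 - d + d = 1 * (p - 1)" "N < p - 1 - d"
    using assms by auto
  ultimately obtain c where c: "\<forall>j. c j \<in> p_integral p"
    "\<And>k. bernoulli (p - 1 - d + k * (p - 1)) / of_nat (p - 1 - d + k * (p - 1)) =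
      (\<Sum>j\<le>k. of_nat (k choose j) * of_nat p ^ min j N * c j)"
    using kummer_congruences[of p N "p - 1 - d"] two_power_not_cong_1[OF assms(1) d(1)] assms by blast
  have "div_bernoulli_shift p k d = (\<Sum>j<k. of_nat ((k - 1) choose j) * of_nat p ^ min j N * c j)"
    if k: "1 \<le> k" for k
  proof -
    obtain i where i: "k = Suc i"
      using k by (cases k) auto
    have "p - 1 - d + i * (p - 1) = k * (p - 1) - d"
      using d by (simp add: i)
    then show ?thesis
      using c(2)[of i] by (simp add: div_bernoulli_shift_def i lessThan_Suc_atMost)
  qed
  then show ?thesis
    using c(1) by blast
qed

lemma p_congI:
  assumes "prime p" "b \<in> p_integral p" "c \<in> p_integral p" "a - b = of_nat p ^ k * c"
  shows "p_cong p k a b"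
proof -
  have "a = b + of_nat p ^ k * c"
    using assms(4) by (simp add: algebra_simps)
  then have "a \<in> p_integral p"
    using assms(1-3) by (auto intro!: p_integral_intros)
  then show ?thesis
    using assms by (auto simp: p_cong_def)
qed

text \<open>The setting in which the congruences are checked: the modulus is \<open>p ^ e\<close>, and \<open>x\<close> and \<open>y\<close>
  are the normalised Newton coefficients of the two families of shifted Bernoulli numbers. These
  families occur with factors \<open>p ^ 2\<close> and \<open>p ^ 4\<close>, so that Kummer's congruences are needed to the
  orders \<open>e - 2\<close> and \<open>e - 4\<close> only.\<close>

locale newton_coordinates =
  fixes p e :: nat and x y r :: "nat \<Rightarrow> rat"
  assumes prime: "prime p" and ge_7: "7 \<le> p" and e: "e = 5 \<or> e = 6 \<and> 11 \<le> p"
    and x [intro]: "x j \<in> p_integral p" and y [intro]: "y j \<in> p_integral p"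
    and newton_2: "1 \<le> k \<Longrightarrow> div_bernoulli_shift p k 2 =
      (\<Sum>j<k. of_nat ((k - 1) choose j) * of_nat p ^ min j (e - 2) * x j)"
    and newton_4: "1 \<le> k \<Longrightarrow> div_bernoulli_shift p k 4 =
      (\<Sum>j<k. of_nat ((k - 1) choose j) * of_nat p ^ min j (e - 4) * y j)"
begin

abbreviation P :: rat where "P \<equiv> of_nat p"
abbreviation Q :: "nat \<Rightarrow> rat" where "Q n \<equiv> of_int (fermat_quotient_sum p n)"
abbreviation B :: "nat \<Rightarrow> rat" where "B \<equiv> div_bernoulli p"
abbreviation C :: "nat \<Rightarrow> nat \<Rightarrow> rat" where "C \<equiv> div_bernoulli_shift p"

text \<open>The expansion of \<open>power_sum_quotient p k\<close> up to \<open>p\<close>-integral multiples of \<open>p ^ e\<close>. The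
  coefficient of \<open>C k 4\<close> is truncated after \<open>p ^ 5\<close>; \<open>s4\<close> and \<open>s3\<close> are the elementary symmetric
  polynomials of degrees 4 and 3 in \<open>k + 1, \<dots>, k + 4\<close>.\<close>

definition G :: "nat \<Rightarrow> rat" where
  "G k = (let K = of_nat k; s3 = 4 * K ^ 3 + 30 * K ^ 2 + 70 * K + 50;
      s4 = (K + 1) * (K + 2) * (K + 3) * (K + 4)
    in (P - 1) * B k
      + P ^ 2 * ((P - 1) * (K * (P - 1) - 1) * (K * (P - 1) - 2) / 6) * C k 2
      + P ^ 4 * ((- s4 + (s4 + K * s3) * P) / 120) * C k 4)"

lemma B_p_integral: "1 \<le> k \<Longrightarrow> k \<le> e \<Longrightarrow> B k \<in> p_integral p"
  using div_bernoulli_p_integral[OF prime ge_7 e] .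

lemma C_p_integral: "1 \<le> k \<Longrightarrow> d \<in> {2, 4} \<Longrightarrow> C k d \<in> p_integral p"
  using div_bernoulli_shift_p_integral[OF prime ge_7] .

lemmas p_integral_rules = p_integral_intros[OF prime] p_integral_divide_numeral[OF prime ge_7]
  B_p_integral C_p_integral x y

lemma power_sum_quotient_cong_G:
  assumes "1 \<le> k" "k \<le> e"
  shows "\<exists>c. c \<in> p_integral p \<and> power_sum_quotient p k = G k + P ^ e * c"
proof -
  define K where "K = (of_nat k :: rat)"
  define s1 where "s1 = 4 * K + 10"
  define s2 where "s2 = 6 * K ^ 2 + 30 * K + 35"
  define s3 where "s3 = 4 * K ^ 3 + 30 * K ^ 2 + 70 * K + 50"
  define s4 where "s4 = (K + 1) * (K + 2) * (K + 3) * (K + 4)"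
  \<comment> \<open>the part of the coefficient of \<open>C k 4\<close> that \<open>G\<close> omits, divided by \<open>P ^ 6\<close>\<close>
  define d where "d = (- (K * s3 + K ^ 2 * s2) + (K ^ 2 * s2 + K ^ 3 * s1) * P
    - (K ^ 3 * s1 + K ^ 4) * P ^ 2 + K ^ 4 * P ^ 3) / 120"
  obtain r where r: "r \<in> p_integral p" "power_sum_quotient p k = (P - 1) * B k
      + P ^ 2 * ((P - 1) * (K * (P - 1) - 1) * (K * (P - 1) - 2) / 6) * C k 2
      + P ^ 4 * ((P - 1) * (K * (P - 1) - 1) * (K * (P - 1) - 2) * (K * (P - 1) - 3)
          * (K * (P - 1) - 4) / 120) * C k 4
      + P ^ e * r"
    using power_sum_quotient_expansion[OF prime ge_7 e assms] by (auto simp: Let_def K_def)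
  have d: "120 * d = - (K * s3 + K ^ 2 * s2) + (K ^ 2 * s2 + K ^ 3 * s1) * P
      - (K ^ 3 * s1 + K ^ 4) * P ^ 2 + K ^ 4 * P ^ 3"
    by (simp add: d_def)
  have prod: "(K * (P - 1) - 1) * (K * (P - 1) - 2) * (K * (P - 1) - 3) * (K * (P - 1) - 4)
      = s4 - K * s3 * P + K ^ 2 * s2 * P ^ 2 - K ^ 3 * s1 * P ^ 3 + K ^ 4 * P ^ 4"
    by (simp add: s1_def s2_def s3_def s4_def algebra_simps power_numeral_reduce)
  have "(P - 1) * (K * (P - 1) - 1) * (K * (P - 1) - 2) * (K * (P - 1) - 3) * (K * (P - 1) - 4)
      = (P - 1) * (s4 - K * s3 * P + K ^ 2 * s2 * P ^ 2 - K ^ 3 * s1 * P ^ 3 + K ^ 4 * P ^ 4)"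
    unfolding prod[symmetric] by (simp only: mult.assoc)
  also have "\<dots> = - s4 + (s4 + K * s3) * P + P ^ 2 * (120 * d)"
    unfolding d by (simp add: algebra_simps power_numeral_reduce)
  finally have "power_sum_quotient p k = G k + P ^ 6 * d * C k 4 + P ^ e * r"
    unfolding r(2) by (simp add: G_def Let_def flip: K_def s3_def s4_def)
      (simp add: algebra_simps add_divide_distrib power_numeral_reduce)
  also have "P ^ 6 = P ^ e * P ^ (6 - e)"
    using e by (auto simp flip: power_add)
  finally have "power_sum_quotient p k = G k + P ^ e * (P ^ (6 - e) * d * C k 4 + r)"
    by (simp add: distrib_left mult.assoc)
  moreover have "P ^ (6 - e) * d * C k 4 + r \<in> p_integral p"
    unfolding d_def s1_def s2_def s3_def K_def
    using r(1) assms(1) by (intro p_integral_rules) auto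
  ultimately show ?thesis
    by blast
qed

lemma fermat_quotient_sum_fwd_diff:
  assumes "1 \<le> n" "n \<le> e"
  shows "\<exists>c\<in>p_integral p. P ^ (n - 1) * Q n / of_nat n = fwd_diff n G + P ^ e * c"
proof -
  have "\<forall>k\<in>{1..n}. \<exists>r. r \<in> p_integral p \<and> power_sum_quotient p k = G k + P ^ e * r"
    using power_sum_quotient_cong_G assms by simp
  then obtain r where r: "\<And>k. k \<in> {1..n} \<Longrightarrow> r k \<in> p_integral p"
    "\<And>k. k \<in> {1..n} \<Longrightarrow> power_sum_quotient p k = G k + P ^ e * r k"
    using bchoice[of "{1..n}" "\<lambda>k r. r \<in> p_integral p \<and> power_sum_quotient p k = G k + P ^ e * r"]
    by blast
  have "P ^ (n - 1) * Q n / of_nat n =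
      (\<Sum>k = 1..n. (-1) ^ (n - k) * of_nat ((n - 1) choose (k - 1)) * (G k + P ^ e * r k))"
    unfolding fermat_quotient_sum_power_sum_quotients[OF prime assms(1)]
    using r(2) by (intro sum.cong) auto
  also have "\<dots> = fwd_diff n G + P ^ e * fwd_diff n r"
    by (simp add: fwd_diff_def algebra_simps sum.distrib sum_distrib_left)
  finally show ?thesis
    using r(1) prime by (auto simp: fwd_diff_def intro!: bexI[of _ "fwd_diff n r"] p_integral_intros)
qed

lemma p_cong_fermat_quotient_sum:
  assumes "1 \<le> n" "n \<le> e" "a = P ^ (n - 1) * Q n / of_nat n"
    and "b \<in> p_integral p" "c \<in> p_integral p" "fwd_diff n G - b = P ^ e * c"
  shows "p_cong p e a b"
proof -
  obtain d where d: "d \<in> p_integral p" "a = fwd_diff n G + P ^ e * d"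
    using fermat_quotient_sum_fwd_diff[OF assms(1,2)] assms(3) by auto
  then have "a - b = P ^ e * (c + d)"
    using assms(6) by (simp add: algebra_simps)
  then show ?thesis
    using prime assms(4,5) d(1) by (intro p_congI) (auto intro: p_integral_add)
qed

text \<open>For \<open>n = e\<close> the expression on the left of the congruence is divisible by \<open>p ^ (e - 1)\<close>,
  because \<open>Q e\<close> is an integer. If the terms with shifted Bernoulli numbers are, too, then so is
  the leading difference.\<close>

lemma fwd_diff_div_bernoulli_divisible:
  assumes "v \<in> p_integral p" "fwd_diff e G = (P - 1) * fwd_diff e B + P ^ (e - 1) * v"
  shows "\<exists>b\<in>p_integral p. fwd_diff e B = P ^ (e - 1) * b"
proof -
  have "1 \<le> e" "\<not> int p dvd int e"
    using e ge_7 by (auto dest!: dvd_imp_le)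
  then obtain c where c: "c \<in> p_integral p" "P ^ (e - 1) * Q e / of_nat e = fwd_diff e G + P ^ e * c"
    using fermat_quotient_sum_fwd_diff[of e] by blast
  have pe: "P ^ e = P ^ (e - 1) * P"
    using \<open>1 \<le> e\<close> by (simp add: power_eq_if)
  define b where "b = (Q e / of_int (int e) - v - P * c) / of_int (int p - 1)"
  have "\<not> int p dvd int p - 1"
    using ge_7 by (auto dest!: zdvd_imp_le)
  then have "b \<in> p_integral p"
    unfolding b_def using prime assms(1) c(1) \<open>\<not> int p dvd int e\<close>
    by (intro p_integral_divide_unit p_integral_diff p_integral_mult) auto
  moreover have "(P - 1) * fwd_diff e B = P ^ (e - 1) * (Q e / of_nat e - v - P * c)"
    using c(2) unfolding assms(2) pe by (simp add: algebra_simps)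
  then have "fwd_diff e B = P ^ (e - 1) * b"
    using ge_7 by (simp add: b_def field_simps)
  ultimately show ?thesis
    by blast
qed

text \<open>These are the sources of the coefficients in the theorem.\<close>

lemma G_expansions:
  shows "G 1 = (P - 1) * B 1 + (- (P^2) + 11/6 * P^3 - P^4 + 1/6 * P^5) * C 1 2
      + (- (P^4) + 137/60 * P^5) * C 1 4"
    "G 2 = (P - 1) * B 2 + (- 2 * P^2 + 13/3 * P^3 - 3 * P^4 + 2/3 * P^5) * C 2 2
      + (- 3 * P^4 + 87/10 * P^5) * C 2 4"
    "G 3 = (P - 1) * B 3 + (- 10/3 * P^2 + 47/6 * P^3 - 6 * P^4 + 3/2 * P^5) * C 3 2
      + (- 7 * P^4 + 459/20 * P^5) * C 3 4"
    "G 4 = (P - 1) * B 4 + (- 5 * P^2 + 37/3 * P^3 - 10 * P^4 + 8/3 * P^5) * C 4 2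
      + (- 14 * P^4 + 743/15 * P^5) * C 4 4"
    "G 5 = (P - 1) * B 5 + (- 7 * P^2 + 107/6 * P^3 - 15 * P^4 + 25/6 * P^5) * C 5 2
      + (- 126/5 * P^4 + 1879/20 * P^5) * C 5 4"
    "G 6 = (P - 1) * B 6 + (- 28/3 * P^2 + 73/3 * P^3 - 21 * P^4 + 6 * P^5) * C 6 2
      + (- 42 * P^4 + 1627/10 * P^5) * C 6 4"
  by (simp_all add: G_def Let_def field_simps power_numeral_reduce)

lemmas ring_expand = algebra_simps power_numeral_reduce add_divide_distrib diff_divide_distrib

lemmas newton_simps = fwd_diff_simps G_expansions

lemma newton_forms_5:
  assumes "e = 5"
  shows "C 1 2 = x 0"
    and "C 2 2 = x 0 + P * x 1"
    and "C 3 2 = x 0 + 2 * P * x 1 + P^2 * x 2"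
    and "C 4 2 = x 0 + 3 * P * x 1 + 3 * P^2 * x 2 + P^3 * x 3"
    and "C 5 2 = x 0 + 4 * P * x 1 + 6 * P^2 * x 2 + 4 * P^3 * x 3 + P^3 * x 4"
    and "C 1 4 = y 0"
    and "C 2 4 = y 0 + P * y 1"
    and "C 3 4 = y 0 + 2 * P * y 1 + P * y 2"
    and "C 4 4 = y 0 + 3 * P * y 1 + 3 * P * y 2 + P * y 3"
    and "C 5 4 = y 0 + 4 * P * y 1 + 6 * P * y 2 + 4 * P * y 3 + P * y 4"
  by (subst newton_2 newton_4, simp, simp add: assms eval_nat_numeral)+

text \<open>In each of the following congruences, \<open>c\<close> is the quotient by \<open>P ^ e\<close> of the difference
  between \<open>fwd_diff n G\<close> and the right-hand side, after the shifted Bernoulli numbers have been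
  expressed by \<open>x\<close> and \<open>y\<close>; that this quotient has no negative powers of \<open>P\<close> is the whole content.\<close>

lemma fermat_quotient_sum_1_mod_p5:
  assumes "e = 5"
  shows "p_cong p e (Q 1)
    ((P - 1) * B 1 - P^2 * C 1 2 + 11/6 * P^3 * C 1 2 - P^4 * (C 1 2 + C 1 4))"
proof (rule p_cong_fermat_quotient_sum[where n = 1 and c =
      "1/6 * x 0
      + 137/60 * y 0"])
  show "1 \<le> (1 :: nat)" "1 \<le> e"
    by (simp_all add: assms)
  show "Q 1 = P ^ (1 - 1) * Q 1 / of_nat 1"
    by simp
qed ((intro p_integral_rules; simp add: assms; fail) |
    (simp only: newton_simps newton_forms_5[OF assms] assms,
      simp add: ring_expand))+

lemma fermat_quotient_sum_2_mod_p5: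
  assumes "e = 5"
  shows "p_cong p e (1/2 * P * Q 2)
    ((P - 1) * (B 2 - B 1) + P^2 * (C 1 2 - 2 * C 2 2)
    + P^3 * (- 11/6 * C 1 2 + 13/3 * C 2 2)
    - P^4 * (2 * C 1 2 + 2 * C 1 4))"
proof (rule p_cong_fermat_quotient_sum[where n = 2 and c =
      "1/2 * x 0
      + (- 3 + 2/3 * P) * x 1
      + 77/12 * y 0
      + (- 3 + 87/10 * P) * y 1"])
  show "1 \<le> (2 :: nat)" "2 \<le> e"
    by (simp_all add: assms)
  show "1/2 * P * Q 2 = P ^ (2 - 1) * Q 2 / of_nat 2"
    by simp
qed ((intro p_integral_rules; simp add: assms; fail) |
    (simp only: newton_simps newton_forms_5[OF assms] assms,
      simp add: ring_expand))+

lemma fermat_quotient_sum_3_mod_p5: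
  assumes "e = 5"
  shows "p_cong p e (1/3 * P^2 * Q 3)
    ((P - 1) * (B 3 - 2 * B 2 + B 1) + P^2 * (- C 1 2 + 4 * C 2 2 - 10/3 * C 3 2)
    + P^3 * (- 6 * C 1 2 + 7 * C 2 2)
    - P^4 * (C 1 2 + 2 * C 1 4))"
proof (rule p_cong_fermat_quotient_sum[where n = 3 and c =
      "1/3 * x 0
      + (- 6 + 5/3 * P) * x 1
      + (47/6 - 6 * P + 3/2 * P^2) * x 2
      + 47/6 * y 0
      + (- 8 + 57/2 * P) * y 1
      + (- 7 + 459/20 * P) * y 2"])
  show "1 \<le> (3 :: nat)" "3 \<le> e"
    by (simp_all add: assms)
  show "1/3 * P^2 * Q 3 = P ^ (3 - 1) * Q 3 / of_nat 3"
    by simp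
qed ((intro p_integral_rules; simp add: assms; fail) |
    (simp only: newton_simps newton_forms_5[OF assms] assms,
      simp add: ring_expand))+

lemma fermat_quotient_sum_4_mod_p5:
  assumes "e = 5"
  shows "p_cong p e (1/4 * P^3 * Q 4)
    ((P - 1) * (B 4 - 3 * B 3 + 3 * B 2 - B 1)
    + P^2 * (- 4 * C 1 2 + 9 * C 2 2 - 5 * C 3 2)
    + P^3 * (- 3 * C 1 2 + 3 * C 2 2)
    - P^4 * C 1 4)"
proof (rule p_cong_fermat_quotient_sum[where n = 4 and c =
      "(- 3 + P) * x 1
      + (27/2 - 12 * P + 7/2 * P^2) * x 2
      + (- 5 + 37/3 * P - 10 * P^2 + 8/3 * P^3) * x 3
      + 9/2 * y 0
      + (- 9 + 37 * P) * y 1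
      + (- 21 + 319/4 * P) * y 2
      + (- 14 + 743/15 * P) * y 3"])
  show "1 \<le> (4 :: nat)" "4 \<le> e"
    by (simp_all add: assms)
  show "1/4 * P^3 * Q 4 = P ^ (4 - 1) * Q 4 / of_nat 4"
    by simp
qed ((intro p_integral_rules; simp add: assms; fail) |
    (simp only: newton_simps newton_forms_5[OF assms] assms,
      simp add: ring_expand))+

text \<open>Here the leading difference is \<open>P ^ 4 * b\<close>, so that its factor \<open>P - 1\<close> may be replaced by
  \<open>- 1\<close> at the cost of adding \<open>b\<close> to the cofactor.\<close>

lemma fermat_quotient_sum_5_mod_p5:
  assumes "e = 5"
  shows "p_cong p e (1/5 * P^4 * Q 5)
    (- (B 5 - 4 * B 4 + 6 * B 3 - 4 * B 2 + B 1)
    + P^2 * (- 2 * C 1 2 + 4 * C 2 2 - 2 * C 3 2)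
    - 1/5 * P^4 * C 1 4)"
proof -
  obtain b where b: "b \<in> p_integral p" "fwd_diff e B = P ^ (e - 1) * b"
  proof -
    let ?v = "(- 2 + 6 * P - 6 * P^2 + 2 * P^3) * x 2
      + (- 8 * P + 22 * P^2 - 20 * P^3 + 6 * P^4) * x 3
      + (- 7 * P + 107/6 * P^2 - 15 * P^3 + 25/6 * P^4) * x 4
      + (- 1/5 + P) * y 0
      + (- 24/5 * P + 22 * P^2) * y 1
      + (- 126/5 * P + 107 * P^2) * y 2
      + (- 224/5 * P + 533/3 * P^2) * y 3
      + (- 126/5 * P + 1879/20 * P^2) * y 4"
    have "fwd_diff e G = (P - 1) * fwd_diff e B + P ^ (e - 1) * ?v"
      by (simp only: newton_simps newton_forms_5[OF assms] assms)
        (simp add: ring_expand)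
    moreover have "?v \<in> p_integral p"
      by (intro p_integral_rules; simp)
    ultimately show ?thesis
      using fwd_diff_div_bernoulli_divisible that by blast
  qed
  have B: "B 5 = 4 * B 4 - 6 * B 3 + 4 * B 2 - B 1 + P ^ 4 * b"
    using b(2) by (simp add: assms fwd_diff_simps)
  show ?thesis
  proof (rule p_cong_fermat_quotient_sum[where n = 5 and c =
      "b + (6 - 6 * P + 2 * P^2) * x 2
      + (- 8 + 22 * P - 20 * P^2 + 6 * P^3) * x 3
      + (- 7 + 107/6 * P - 15 * P^2 + 25/6 * P^3) * x 4
      + y 0
      + (- 24/5 + 22 * P) * y 1
      + (- 126/5 + 107 * P) * y 2
      + (- 224/5 + 533/3 * P) * y 3
      + (- 126/5 + 1879/20 * P) * y 4"])
    show "1 \<le> (5 :: nat)" "5 \<le> e"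
      by (simp_all add: assms)
    show "1/5 * P^4 * Q 5 = P ^ (5 - 1) * Q 5 / of_nat 5"
      by simp
  qed ((intro p_integral_rules b(1); simp add: assms; fail) |
    (simp only: newton_simps newton_forms_5[OF assms] assms B,
      simp add: ring_expand))+
qed

lemma newton_forms_6:
  assumes "e = 6"
  shows "C 1 2 = x 0"
    and "C 2 2 = x 0 + P * x 1"
    and "C 3 2 = x 0 + 2 * P * x 1 + P^2 * x 2"
    and "C 4 2 = x 0 + 3 * P * x 1 + 3 * P^2 * x 2 + P^3 * x 3"
    and "C 5 2 = x 0 + 4 * P * x 1 + 6 * P^2 * x 2 + 4 * P^3 * x 3 + P^4 * x 4"
    and "C 6 2 = x 0 + 5 * P * x 1 + 10 * P^2 * x 2 + 10 * P^3 * x 3 + 5 * P^4 * x 4 + P^4 * x 5"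
    and "C 1 4 = y 0"
    and "C 2 4 = y 0 + P * y 1"
    and "C 3 4 = y 0 + 2 * P * y 1 + P^2 * y 2"
    and "C 4 4 = y 0 + 3 * P * y 1 + 3 * P^2 * y 2 + P^2 * y 3"
    and "C 5 4 = y 0 + 4 * P * y 1 + 6 * P^2 * y 2 + 4 * P^2 * y 3 + P^2 * y 4"
    and "C 6 4 = y 0 + 5 * P * y 1 + 10 * P^2 * y 2 + 10 * P^2 * y 3 + 5 * P^2 * y 4 + P^2 * y 5"
  by (subst newton_2 newton_4, simp, simp add: assms eval_nat_numeral)+

lemma fermat_quotient_sum_1_mod_p6:
  assumes "e = 6"
  shows "p_cong p e (Q 1)
    ((P - 1) * B 1 - P^2 * C 1 2 + 11/6 * P^3 * C 1 2 - P^4 * (C 1 2 + C 1 4)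
    + P^5 * (1/6 * C 1 2 + 137/60 * C 1 4))"
proof (rule p_cong_fermat_quotient_sum[where n = 1 and c = "0"])
  show "1 \<le> (1 :: nat)" "1 \<le> e"
    by (simp_all add: assms)
  show "Q 1 = P ^ (1 - 1) * Q 1 / of_nat 1"
    by simp
qed ((intro p_integral_rules; simp add: assms; fail) |
    (simp only: newton_simps newton_forms_6[OF assms] assms,
      simp add: ring_expand))+

lemma fermat_quotient_sum_2_mod_p6:
  assumes "e = 6"
  shows "p_cong p e (1/2 * P * Q 2)
    ((P - 1) * (B 2 - B 1) + P^2 * (C 1 2 - 2 * C 2 2)
    + P^3 * (- 11/6 * C 1 2 + 13/3 * C 2 2)
    + P^4 * (C 1 2 - 3 * C 2 2 + C 1 4 - 3 * C 2 4)
    + P^5 * (1/2 * C 1 2 + 77/12 * C 1 4))"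
proof (rule p_cong_fermat_quotient_sum[where n = 2 and c =
      "2/3 * x 1
      + 87/10 * y 1"])
  show "1 \<le> (2 :: nat)" "2 \<le> e"
    by (simp_all add: assms)
  show "1/2 * P * Q 2 = P ^ (2 - 1) * Q 2 / of_nat 2"
    by simp
qed ((intro p_integral_rules; simp add: assms; fail) |
    (simp only: newton_simps newton_forms_6[OF assms] assms,
      simp add: ring_expand))+

lemma fermat_quotient_sum_3_mod_p6:
  assumes "e = 6"
  shows "p_cong p e (1/3 * P^2 * Q 3)
    ((P - 1) * (B 3 - 2 * B 2 + B 1) + P^2 * (- C 1 2 + 4 * C 2 2 - 10/3 * C 3 2)
    + P^3 * (11/6 * C 1 2 - 26/3 * C 2 2 + 47/6 * C 3 2)
    + P^4 * (5 * C 1 2 - 6 * C 2 2 + 6 * C 1 4 - 8 * C 2 4)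
    + P^5 * (1/3 * C 1 2 + 47/6 * C 1 4))"
proof (rule p_cong_fermat_quotient_sum[where n = 3 and c =
      "5/3 * x 1
      + (- 6 + 3/2 * P) * x 2
      + 57/2 * y 1
      + (- 7 + 459/20 * P) * y 2"])
  show "1 \<le> (3 :: nat)" "3 \<le> e"
    by (simp_all add: assms)
  show "1/3 * P^2 * Q 3 = P ^ (3 - 1) * Q 3 / of_nat 3"
    by simp
qed ((intro p_integral_rules; simp add: assms; fail) |
    (simp only: newton_simps newton_forms_6[OF assms] assms,
      simp add: ring_expand))+

lemma fermat_quotient_sum_4_mod_p6:
  assumes "e = 6"
  shows "p_cong p e (1/4 * P^3 * Q 4)
    ((P - 1) * (B 4 - 3 * B 3 + 3 * B 2 - B 1)
    + P^2 * (C 1 2 - 6 * C 2 2 + 10 * C 3 2 - 5 * C 4 2)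
    + P^3 * (21/2 * C 1 2 - 24 * C 2 2 + 27/2 * C 3 2)
    + P^4 * (3 * C 1 2 - 3 * C 2 2 + 8 * C 1 4 - 9 * C 2 4)
    + 9/2 * P^5 * C 1 4)"
proof (rule p_cong_fermat_quotient_sum[where n = 4 and c =
      "x 1
      + (- 12 + 7/2 * P) * x 2
      + (37/3 - 10 * P + 8/3 * P^2) * x 3
      + 37 * y 1
      + (- 21 + 319/4 * P) * y 2
      + (- 14 + 743/15 * P) * y 3"])
  show "1 \<le> (4 :: nat)" "4 \<le> e"
    by (simp_all add: assms)
  show "1/4 * P^3 * Q 4 = P ^ (4 - 1) * Q 4 / of_nat 4"
    by simp
qed ((intro p_integral_rules; simp add: assms; fail) |
    (simp only: newton_simps newton_forms_6[OF assms] assms,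
      simp add: ring_expand))+

lemma fermat_quotient_sum_5_mod_p6:
  assumes "e = 6"
  shows "p_cong p e (1/5 * P^4 * Q 5)
    ((P - 1) * (B 5 - 4 * B 4 + 6 * B 3 - 4 * B 2 + B 1)
    + P^2 * (6 * C 1 2 - 20 * C 2 2 + 22 * C 3 2 - 8 * C 4 2)
    + P^3 * (6 * C 1 2 - 12 * C 2 2 + 6 * C 3 2)
    + P^4 * (23/5 * C 1 4 - 24/5 * C 2 4)
    + P^5 * C 1 4)"
proof (rule p_cong_fermat_quotient_sum[where n = 5 and c =
      "(- 6 + 2 * P) * x 2
      + (22 - 20 * P + 6 * P^2) * x 3
      + (- 7 + 107/6 * P - 15 * P^2 + 25/6 * P^3) * x 4
      + 22 * y 1
      + (- 126/5 + 107 * P) * y 2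
      + (- 224/5 + 533/3 * P) * y 3
      + (- 126/5 + 1879/20 * P) * y 4"])
  show "1 \<le> (5 :: nat)" "5 \<le> e"
    by (simp_all add: assms)
  show "1/5 * P^4 * Q 5 = P ^ (5 - 1) * Q 5 / of_nat 5"
    by simp
qed ((intro p_integral_rules; simp add: assms; fail) |
    (simp only: newton_simps newton_forms_6[OF assms] assms,
      simp add: ring_expand))+

text \<open>Again \<open>P - 1\<close> is replaced by \<open>- 1\<close>, the leading difference being \<open>P ^ 5 * b\<close>.\<close>

lemma fermat_quotient_sum_6_mod_p6:
  assumes "e = 6"
  shows "p_cong p e (1/6 * P^5 * Q 6)
    (- (B 6 - 5 * B 5 + 10 * B 4 - 10 * B 3 + 5 * B 2 - B 1)
    + P^2 * (10/3 * C 1 2 - 10 * C 2 2 + 10 * C 3 2 - 10/3 * C 4 2)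
    + P^4 * (C 1 4 - C 2 4))"
proof -
  obtain b where b: "b \<in> p_integral p" "fwd_diff e B = P ^ (e - 1) * b"
  proof -
    let ?v = "(- 10/3 + 10 * P - 10 * P^2 + 10/3 * P^3) * x 3
      + (- 35/3 * P + 65/2 * P^2 - 30 * P^3 + 55/6 * P^4) * x 4
      + (- 28/3 * P + 73/3 * P^2 - 21 * P^3 + 6 * P^4) * x 5
      + (- 1 + 5 * P) * y 1
      + (- 14 * P + 65 * P^2) * y 2
      + (- 56 * P + 730/3 * P^2) * y 3
      + (- 84 * P + 1375/4 * P^2) * y 4
      + (- 42 * P + 1627/10 * P^2) * y 5"
    have "fwd_diff e G = (P - 1) * fwd_diff e B + P ^ (e - 1) * ?v"
      by (simp only: newton_simps newton_forms_6[OF assms] assms)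
        (simp add: ring_expand)
    moreover have "?v \<in> p_integral p"
      by (intro p_integral_rules; simp)
    ultimately show ?thesis
      using fwd_diff_div_bernoulli_divisible that by blast
  qed
  have B: "B 6 = 5 * B 5 - 10 * B 4 + 10 * B 3 - 5 * B 2 + B 1 + P ^ 5 * b"
    using b(2) by (simp add: assms fwd_diff_simps)
  show ?thesis
  proof (rule p_cong_fermat_quotient_sum[where n = 6 and c =
      "b + (10 - 10 * P + 10/3 * P^2) * x 3
      + (- 35/3 + 65/2 * P - 30 * P^2 + 55/6 * P^3) * x 4
      + (- 28/3 + 73/3 * P - 21 * P^2 + 6 * P^3) * x 5
      + 5 * y 1
      + (- 14 + 65 * P) * y 2
      + (- 56 + 730/3 * P) * y 3
      + (- 84 + 1375/4 * P) * y 4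
      + (- 42 + 1627/10 * P) * y 5"])
    show "1 \<le> (6 :: nat)" "6 \<le> e"
      by (simp_all add: assms)
    show "1/6 * P^5 * Q 6 = P ^ (6 - 1) * Q 6 / of_nat 6"
      by simp
  qed ((intro p_integral_rules b(1); simp add: assms; fail) |
    (simp only: newton_simps newton_forms_6[OF assms] assms B,
      simp add: ring_expand))+
qed

end

lemma newton_coordinates_exist:
  assumes "prime p" "7 \<le> p" "e = 5 \<or> e = 6 \<and> 11 \<le> p"
  shows "\<exists>x y. newton_coordinates p e x y"
proof -
  have "e - 2 + 2 + 2 \<le> p" "e - 4 + 4 + 2 \<le> p"
    using assms(2,3) by auto
  then obtain x y where "\<forall>j. x j \<in> p_integral p" "\<forall>j. y j \<in> p_integral p"
    "\<forall>k\<ge>1. div_bernoulli_shift p k 2 =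
      (\<Sum>j<k. of_nat ((k - 1) choose j) * of_nat p ^ min j (e - 2) * x j)"
    "\<forall>k\<ge>1. div_bernoulli_shift p k 4 =
      (\<Sum>j<k. of_nat ((k - 1) choose j) * of_nat p ^ min j (e - 4) * y j)"
    using div_bernoulli_shift_newton[OF assms(1,2), of 2 "e - 2"]
      div_bernoulli_shift_newton[OF assms(1,2), of 4 "e - 4"] by auto
  then have "newton_coordinates p e x y"
    using assms by unfold_locales auto
  then show ?thesis
    by blast
qed

theorem theorem1p3:
  fixes p :: nat
  assumes "prime p" and "odd p"
  shows
    "let P = (of_nat p :: rat);
         Q = (\<lambda>n. of_int (fermat_quotient_sum p n) :: rat);
         B = div_bernoulli p;
         C = div_bernoulli_shift p
     in
       (11 \<le> p \<longrightarrow> p_cong p 6 (Q 1)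
          ((P - 1) * B 1 - P^2 * C 1 2 + 11/6 * P^3 * C 1 2 - P^4 * (C 1 2 + C 1 4)
            + P^5 * (1/6 * C 1 2 + 137/60 * C 1 4)))
     \<and> (7 \<le> p \<longrightarrow> p_cong p 5 (Q 1)
          ((P - 1) * B 1 - P^2 * C 1 2 + 11/6 * P^3 * C 1 2 - P^4 * (C 1 2 + C 1 4)))

     \<and> (11 \<le> p \<longrightarrow> p_cong p 6 (1/2 * P * Q 2)
          ((P - 1) * (B 2 - B 1) + P^2 * (C 1 2 - 2 * C 2 2)
            + P^3 * (- 11/6 * C 1 2 + 13/3 * C 2 2)
            + P^4 * (C 1 2 - 3 * C 2 2 + C 1 4 - 3 * C 2 4)
            + P^5 * (1/2 * C 1 2 + 77/12 * C 1 4)))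
     \<and> (7 \<le> p \<longrightarrow> p_cong p 5 (1/2 * P * Q 2)
          ((P - 1) * (B 2 - B 1) + P^2 * (C 1 2 - 2 * C 2 2)
            + P^3 * (- 11/6 * C 1 2 + 13/3 * C 2 2)
            - P^4 * (2 * C 1 2 + 2 * C 1 4)))

     \<and> (11 \<le> p \<longrightarrow> p_cong p 6 (1/3 * P^2 * Q 3)
          ((P - 1) * (B 3 - 2 * B 2 + B 1) + P^2 * (- C 1 2 + 4 * C 2 2 - 10/3 * C 3 2)
            + P^3 * (11/6 * C 1 2 - 26/3 * C 2 2 + 47/6 * C 3 2)
            + P^4 * (5 * C 1 2 - 6 * C 2 2 + 6 * C 1 4 - 8 * C 2 4)
            + P^5 * (1/3 * C 1 2 + 47/6 * C 1 4)))
     \<and> (7 \<le> p \<longrightarrow> p_cong p 5 (1/3 * P^2 * Q 3)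
          ((P - 1) * (B 3 - 2 * B 2 + B 1) + P^2 * (- C 1 2 + 4 * C 2 2 - 10/3 * C 3 2)
            + P^3 * (- 6 * C 1 2 + 7 * C 2 2)
            - P^4 * (C 1 2 + 2 * C 1 4)))

     \<and> (11 \<le> p \<longrightarrow> p_cong p 6 (1/4 * P^3 * Q 4)
          ((P - 1) * (B 4 - 3 * B 3 + 3 * B 2 - B 1)
            + P^2 * (C 1 2 - 6 * C 2 2 + 10 * C 3 2 - 5 * C 4 2)
            + P^3 * (21/2 * C 1 2 - 24 * C 2 2 + 27/2 * C 3 2)
            + P^4 * (3 * C 1 2 - 3 * C 2 2 + 8 * C 1 4 - 9 * C 2 4)
            + 9/2 * P^5 * C 1 4))
     \<and> (7 \<le> p \<longrightarrow> p_cong p 5 (1/4 * P^3 * Q 4)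
          ((P - 1) * (B 4 - 3 * B 3 + 3 * B 2 - B 1)
            + P^2 * (- 4 * C 1 2 + 9 * C 2 2 - 5 * C 3 2)
            + P^3 * (- 3 * C 1 2 + 3 * C 2 2)
            - P^4 * C 1 4))

     \<and> (11 \<le> p \<longrightarrow> p_cong p 6 (1/5 * P^4 * Q 5)
          ((P - 1) * (B 5 - 4 * B 4 + 6 * B 3 - 4 * B 2 + B 1)
            + P^2 * (6 * C 1 2 - 20 * C 2 2 + 22 * C 3 2 - 8 * C 4 2)
            + P^3 * (6 * C 1 2 - 12 * C 2 2 + 6 * C 3 2)
            + P^4 * (23/5 * C 1 4 - 24/5 * C 2 4)
            + P^5 * C 1 4))
     \<and> (7 \<le> p \<longrightarrow> p_cong p 5 (1/5 * P^4 * Q 5)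
          (- (B 5 - 4 * B 4 + 6 * B 3 - 4 * B 2 + B 1)
            + P^2 * (- 2 * C 1 2 + 4 * C 2 2 - 2 * C 3 2)
            - 1/5 * P^4 * C 1 4))

     \<and> (11 \<le> p \<longrightarrow> p_cong p 6 (1/6 * P^5 * Q 6)
          (- (B 6 - 5 * B 5 + 10 * B 4 - 10 * B 3 + 5 * B 2 - B 1)
            + P^2 * (10/3 * C 1 2 - 10 * C 2 2 + 10 * C 3 2 - 10/3 * C 4 2)
            + P^4 * (C 1 4 - C 2 4)))"
proof -
  have "\<exists>x y. 7 \<le> p \<longrightarrow> newton_coordinates p 5 x y"
    using newton_coordinates_exist[OF assms(1), of 5] by simp
  then obtain x y where five: "7 \<le> p \<Longrightarrow> newton_coordinates p 5 x y"
    by blast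
  have "\<exists>x y. 11 \<le> p \<longrightarrow> newton_coordinates p 6 x y"
    using newton_coordinates_exist[OF assms(1), of 6] by simp
  then obtain x' y' where six: "11 \<le> p \<Longrightarrow> newton_coordinates p 6 x' y'"
    by blast
  note mod_p5 =
    newton_coordinates.fermat_quotient_sum_1_mod_p5[OF five refl]
    newton_coordinates.fermat_quotient_sum_2_mod_p5[OF five refl]
    newton_coordinates.fermat_quotient_sum_3_mod_p5[OF five refl]
    newton_coordinates.fermat_quotient_sum_4_mod_p5[OF five refl]
    newton_coordinates.fermat_quotient_sum_5_mod_p5[OF five refl]
  note mod_p6 =
    newton_coordinates.fermat_quotient_sum_1_mod_p6[OF six refl]
    newton_coordinates.fermat_quotient_sum_2_mod_p6[OF six refl]
    newton_coordinates.fermat_quotient_sum_3_mod_p6[OF six refl]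
    newton_coordinates.fermat_quotient_sum_4_mod_p6[OF six refl]
    newton_coordinates.fermat_quotient_sum_5_mod_p6[OF six refl]
    newton_coordinates.fermat_quotient_sum_6_mod_p6[OF six refl]
  show ?thesis
    unfolding Let_def by (intro conjI impI mod_p5 mod_p6; assumption)
qed

end
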